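(* Let $\Delta$ be a simplicial tree and let $k$ be a field. Then there is a monomial ideal $I$ in a polynomial ring $S$ over $k$ such that $\Delta$ is the Scarf complex of $I$ and $\Delta$ (with the labeling of its vertices by the minimal monomial generators of $I$) supports a minimal free resolution of $S/I$.
   Context: A simplicial complex $\Delta$ on a nonempty finite vertex set $V=\{v_1,\ldots,v_n\}$ is a collection of subsets of $V$ (faces), closed under taking subsets, with $\{v_i\}\in\Delta$ for all $i$. Facets are the faces maximal under inclusion. A subcollection of $\Delta$ is a simplicial complex generated by a subset of the set of facets of $\Delta$. A facet $F$ of a simplicial complex is a leaf if either it is the only facet, or there is a facet $G\neq F$ such that $F\cap H\subseteq G$ for every facet $H\neq F$. A simplicial tree is a connected simplicial complex such that every nonempty subcollection (i.e. generated by a nonempty set of facets) has a leaf. Scarf complex: let $I$ be a monomial ideal with minimal monomial generators $m_1,\ldots,m_n$. Label each subset $A\subseteq\{1,\ldots,n\}$ by $m_A=\mathrm{lcm}(m_i : i\in A)$, with $m_\emptyset=1$. The Scarf complex of $I$ is the simplicial complex of all $A\subseteq\{1,\ldots,n\}$ such that $m_B\neq m_A$ for every $B\subseteq\{1,\ldots,n\}$ with $B\neq A$. Supporting a resolution: for a simplicial complex $\Delta$ with vertices $1,\ldots,n$ labeled by the monomials $m_1,\ldots,m_n$ and each face $A$ labeled by $m_A=\mathrm{lcm}(m_i : i\in A)$, with $m_\emptyset=1$, $\mathcal{C}(\Delta;S)$ is the complex of free $S$-modules with basis $\{e_A : A\in\Delta\}$ (including $A=\emptyset$), $e_A$ in homological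 degree $|A|$, with differential $\partial(e_A)=\sum_{i\in A}\mathrm{sign}(i,A)\frac{m_A}{m_{A\setminus\{i\}}}e_{A\setminus\{i\}}$, where $\mathrm{sign}(i,A)=(-1)^{j-1}$ if $i$ is the $j$-th smallest element of $A$. $\Delta$ supports a (minimal) resolution of $I$ if $\mathcal{C}(\Delta;S)$ is a (minimal) free resolution of $S/I$. *)

theory Defs
  imports "HOL-Library.Poly_Mapping" "HOL-Algebra.QuotRing" "HOL-Algebra.Module"
begin

section \<open>Simplicial complexes and simplicial trees\<close>

definition simplicial_complex :: "'v set \<Rightarrow> 'v set set \<Rightarrow> bool" where
  "simplicial_complex V \<Delta> \<longleftrightarrow>
     finite V \<and> V \<noteq> {} \<and> \<Delta> \<subseteq> Pow V \<and>
     (\<forall>A\<in>\<Delta>. \<forall>B. B \<subseteq> A \<longrightarrow> B \<in> \<Delta>) \<and> (\<forall>v\<in>V. {v} \<in> \<Delta>)"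

definition facets :: "'v set set \<Rightarrow> 'v set set" where
  "facets \<Delta> = {F \<in> \<Delta>. \<forall>G\<in>\<Delta>. F \<subseteq> G \<longrightarrow> G = F}"

definition generated_complex :: "'v set set \<Rightarrow> 'v set set" where
  "generated_complex \<F> = {A. \<exists>F\<in>\<F>. A \<subseteq> F}"

definition leaf :: "'v set set \<Rightarrow> 'v set \<Rightarrow> bool" where
  "leaf \<Delta> F \<longleftrightarrow>
     F \<in> facets \<Delta> \<and>
     (facets \<Delta> = {F} \<or>
      (\<exists>G\<in>facets \<Delta>. G \<noteq> F \<and> (\<forall>H\<in>facets \<Delta>. H \<noteq> F \<longrightarrow> F \<inter> H \<subseteq> G)))"

text \<open>Any two facets are joined by a chain of facets in which consecutive ones meet.\<close>

definition connected_complex :: "'v set set \<Rightarrow> bool" where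
  "connected_complex \<Delta> \<longleftrightarrow>
     (\<forall>F\<in>facets \<Delta>. \<forall>G\<in>facets \<Delta>.
        (F, G) \<in> {(A, B). A \<in> facets \<Delta> \<and> B \<in> facets \<Delta> \<and> A \<inter> B \<noteq> {}}\<^sup>*)"

definition simplicial_tree :: "'v set \<Rightarrow> 'v set set \<Rightarrow> bool" where
  "simplicial_tree V \<Delta> \<longleftrightarrow>
     simplicial_complex V \<Delta> \<and> connected_complex \<Delta> \<and>
     (\<forall>\<F>. \<F> \<subseteq> facets \<Delta> \<and> \<F> \<noteq> {} \<longrightarrow> (\<exists>F. leaf (generated_complex \<F>) F))"

section \<open>Polynomial rings and monomial ideals\<close>

text \<open>
  A monomial is identified with its exponent vector \<open>t :: nat \<Rightarrow>\<^sub>0 nat\<close>, so that products and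
  exact quotients of monomials are sums and differences of exponent vectors. The polynomial ring
  in the variables \<open>x\<^sub>0, \<dots>, x\<^sub>N\<^sub>-\<^sub>1\<close> consists of the finitely supported functions from such
  exponent vectors to the field, with the convolution product of \<^theory>\<open>HOL-Library.Poly_Mapping\<close>.
\<close>

definition monomials :: "nat \<Rightarrow> (nat \<Rightarrow>\<^sub>0 nat) set" where
  "monomials N = {t. Poly_Mapping.keys t \<subseteq> {..<N}}"

definition poly_ring :: "nat \<Rightarrow> ((nat \<Rightarrow>\<^sub>0 nat) \<Rightarrow>\<^sub>0 'k::field) ring" where
  "poly_ring N =
     \<lparr>carrier = {p. Poly_Mapping.keys p \<subseteq> monomials N},
      mult = (*), one = 1, zero = 0, add = (+)\<rparr>"

definition monomial :: "(nat \<Rightarrow>\<^sub>0 nat) \<Rightarrow> (nat \<Rightarrow>\<^sub>0 nat) \<Rightarrow>\<^sub>0 'k::field" where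
  "monomial t = Poly_Mapping.single t 1"

definition irrelevant_ideal :: "nat \<Rightarrow> ((nat \<Rightarrow>\<^sub>0 nat) \<Rightarrow>\<^sub>0 'k::field) set" where
  "irrelevant_ideal N =
     genideal (poly_ring N) ((\<lambda>i. monomial (Poly_Mapping.single i 1)) ` {..<N})"

definition monomial_ideal :: "nat \<Rightarrow> ((nat \<Rightarrow>\<^sub>0 nat) \<Rightarrow>\<^sub>0 'k::field) set \<Rightarrow> bool" where
  "monomial_ideal N I \<longleftrightarrow> (\<exists>T \<subseteq> monomials N. I = genideal (poly_ring N) (monomial ` T))"

definition minimal_monomial_generators ::
    "nat \<Rightarrow> ((nat \<Rightarrow>\<^sub>0 nat) \<Rightarrow>\<^sub>0 'k::field) set \<Rightarrow> (nat \<Rightarrow>\<^sub>0 nat) set \<Rightarrow> bool" where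
  "minimal_monomial_generators N I T \<longleftrightarrow>
     T \<subseteq> monomials N \<and> genideal (poly_ring N) (monomial ` T) = I \<and>
     (\<forall>U. U \<subset> T \<longrightarrow> genideal (poly_ring N) (monomial ` U) \<noteq> I)"

section \<open>The Scarf complex\<close>

text \<open>
  The label \<open>m\<^sub>A = lcm (m\<^sub>i : i \<in> A)\<close> of a finite set \<open>A\<close>; inserting \<open>0\<close> gives \<open>m\<^sub>\<emptyset> = 1\<close>.
\<close>

definition lcm_label :: "(nat \<Rightarrow> nat \<Rightarrow>\<^sub>0 nat) \<Rightarrow> nat set \<Rightarrow> nat \<Rightarrow>\<^sub>0 nat" where
  "lcm_label m A =
     Abs_poly_mapping (\<lambda>x. Max (insert 0 ((\<lambda>i. Poly_Mapping.lookup (m i) x) ` A)))"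

lemma lookup_lcm_label:
  assumes "finite A"
  shows "Poly_Mapping.lookup (lcm_label m A) x =
           Max (insert 0 ((\<lambda>i. Poly_Mapping.lookup (m i) x) ` A))"
proof -
  have "{x. Max (insert 0 ((\<lambda>i. Poly_Mapping.lookup (m i) x) ` A)) \<noteq> 0}
          \<subseteq> (\<Union>i\<in>A. Poly_Mapping.keys (m i))"
  proof
    fix x assume "x \<in> {x. Max (insert 0 ((\<lambda>i. Poly_Mapping.lookup (m i) x) ` A)) \<noteq> 0}"
    moreover have "Max (insert 0 ((\<lambda>i. Poly_Mapping.lookup (m i) x) ` A))
                     \<in> insert 0 ((\<lambda>i. Poly_Mapping.lookup (m i) x) ` A)"
      using assms by (intro Max_in) auto
    ultimately show "x \<in> (\<Union>i\<in>A. Poly_Mapping.keys (m i))"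
      by (auto simp: in_keys_iff simp del: Max_insert)
  qed
  then have "finite {x. Max (insert 0 ((\<lambda>i. Poly_Mapping.lookup (m i) x) ` A)) \<noteq> 0}"
    by (rule finite_subset) (use assms in auto)
  then show ?thesis
    by (simp add: lcm_label_def)
qed

definition scarf_complex :: "nat \<Rightarrow> (nat \<Rightarrow> nat \<Rightarrow>\<^sub>0 nat) \<Rightarrow> nat set set" where
  "scarf_complex n m =
     {A. A \<subseteq> {1..n} \<and> (\<forall>B. B \<subseteq> {1..n} \<and> B \<noteq> A \<longrightarrow> lcm_label m B \<noteq> lcm_label m A)}"

section \<open>Minimal free resolutions\<close>

definition linear_maps ::
    "('a, 'x) ring_scheme \<Rightarrow> ('a, 'b, 'y) module_scheme \<Rightarrow> ('a, 'c, 'z) module_scheme \<Rightarrow>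
       ('b \<Rightarrow> 'c) set" where
  "linear_maps R M M' =
     {h \<in> carrier M \<rightarrow> carrier M'.
        (\<forall>x\<in>carrier M. \<forall>y\<in>carrier M. h (x \<oplus>\<^bsub>M\<^esub> y) = h x \<oplus>\<^bsub>M'\<^esub> h y) \<and>
        (\<forall>a\<in>carrier R. \<forall>x\<in>carrier M. h (a \<odot>\<^bsub>M\<^esub> x) = a \<odot>\<^bsub>M'\<^esub> h x)}"

definition module_basis ::
    "('a, 'x) ring_scheme \<Rightarrow> ('a, 'b, 'y) module_scheme \<Rightarrow> 'b set \<Rightarrow> bool" where
  "module_basis R M E \<longleftrightarrow>
     E \<subseteq> carrier M \<and>
     (\<forall>x\<in>carrier M. \<exists>!c.
        c \<in> E \<rightarrow> carrier R \<and> (\<forall>e. e \<notin> E \<longrightarrow> c e = \<zero>\<^bsub>R\<^esub>) \<and>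
        finite {e. c e \<noteq> \<zero>\<^bsub>R\<^esub>} \<and>
        x = (\<Oplus>\<^bsub>M\<^esub>e\<in>{e. c e \<noteq> \<zero>\<^bsub>R\<^esub>}. c e \<odot>\<^bsub>M\<^esub> e))"

definition free_module :: "('a, 'x) ring_scheme \<Rightarrow> ('a, 'b, 'y) module_scheme \<Rightarrow> bool" where
  "free_module R M \<longleftrightarrow> module R M \<and> (\<exists>E. module_basis R M E)"

text \<open>
  The differential \<open>d i\<close> goes from \<open>F i\<close> to \<open>F (i - 1)\<close>; only \<open>i > 0\<close> matters.
\<close>

definition free_resolution ::
    "('a, 'x) ring_scheme \<Rightarrow> (nat \<Rightarrow> ('a, 'b, 'y) module_scheme) \<Rightarrow> (nat \<Rightarrow> 'b \<Rightarrow> 'b) \<Rightarrow>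
       ('a, 'c, 'z) module_scheme \<Rightarrow> bool" where
  "free_resolution R F d M \<longleftrightarrow>
     module R M \<and>
     (\<forall>i. free_module R (F i)) \<and>
     (\<forall>i. d (Suc i) \<in> linear_maps R (F (Suc i)) (F i)) \<and>
     (\<forall>i. d (Suc (Suc i)) ` carrier (F (Suc (Suc i))) =
            {x \<in> carrier (F (Suc i)). d (Suc i) x = \<zero>\<^bsub>F i\<^esub>}) \<and>
     (\<exists>\<epsilon> \<in> linear_maps R (F 0) M.
        \<epsilon> ` carrier (F 0) = carrier M \<and>
        d 1 ` carrier (F 1) = {x \<in> carrier (F 0). \<epsilon> x = \<zero>\<^bsub>M\<^esub>})"

definition ideal_smult_module ::
    "('a, 'x) ring_scheme \<Rightarrow> 'a set \<Rightarrow> ('a, 'b, 'y) module_scheme \<Rightarrow> 'b set" where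
  "ideal_smult_module R J M =
     \<Inter>{H. submodule H R M \<and> (\<forall>a\<in>J. \<forall>x\<in>carrier M. a \<odot>\<^bsub>M\<^esub> x \<in> H)}"

definition minimal_free_resolution ::
    "nat \<Rightarrow> (nat \<Rightarrow> ((nat \<Rightarrow>\<^sub>0 nat) \<Rightarrow>\<^sub>0 'k::field, 'b, 'y) module_scheme) \<Rightarrow> (nat \<Rightarrow> 'b \<Rightarrow> 'b) \<Rightarrow>
       ((nat \<Rightarrow>\<^sub>0 nat) \<Rightarrow>\<^sub>0 'k, 'c, 'z) module_scheme \<Rightarrow> bool" where
  "minimal_free_resolution N F d M \<longleftrightarrow>
     free_resolution (poly_ring N) F d M \<and>
     (\<forall>i. d (Suc i) ` carrier (F (Suc i))
            \<subseteq> ideal_smult_module (poly_ring N) (irrelevant_ideal N) (F i))"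

text \<open>The quotient ring \<open>R / I\<close> as an \<open>R\<close>-module.\<close>

definition quotient_module :: "('a, 'x) ring_scheme \<Rightarrow> 'a set \<Rightarrow> ('a, 'a set) module" where
  "quotient_module R I =
     ring.extend (R Quot I) \<lparr>smult = (\<lambda>a X. (I +>\<^bsub>R\<^esub> a) \<otimes>\<^bsub>R Quot I\<^esub> X)\<rparr>"

section \<open>The complex of a labeled simplicial complex\<close>

text \<open>
  In homological degree \<open>i\<close>, an element is the family of its coefficients with respect to the basis
  \<open>e\<^sub>A\<close>, where \<open>A\<close> ranges over the faces with \<open>i\<close> elements; the coefficients at all other sets are
  zero. The ring multiplication and unit of the module record play no role.
\<close>

definition face_module ::
    "nat \<Rightarrow> nat set set \<Rightarrow> nat \<Rightarrow>
       ((nat \<Rightarrow>\<^sub>0 nat) \<Rightarrow>\<^sub>0 'k::field, nat set \<Rightarrow> (nat \<Rightarrow>\<^sub>0 nat) \<Rightarrow>\<^sub>0 'k) module" where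
  "face_module N \<Delta> i =
     \<lparr>carrier = {f. (\<forall>A. f A \<in> carrier (poly_ring N)) \<and> (\<forall>A. \<not> (A \<in> \<Delta> \<and> card A = i) \<longrightarrow> f A = 0)},
      mult = undefined, one = undefined,
      zero = (\<lambda>A. 0), add = (\<lambda>f g A. f A + g A), smult = (\<lambda>p f A. p * f A)\<rparr>"

definition face_basis :: "nat set \<Rightarrow> nat set \<Rightarrow> (nat \<Rightarrow>\<^sub>0 nat) \<Rightarrow>\<^sub>0 'k::field" where
  "face_basis A = (\<lambda>B. if B = A then 1 else 0)"

text \<open>
  If \<open>i\<close> is the \<open>j\<close>-th smallest element of \<open>A\<close>, then exactly \<open>j - 1\<close> elements of \<open>A\<close> are smaller.
\<close>

definition face_sign :: "nat \<Rightarrow> nat set \<Rightarrow> 'a::comm_ring_1" where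
  "face_sign i A = (- 1) ^ card {j \<in> A. j < i}"

definition boundary_of_face ::
    "(nat \<Rightarrow> nat \<Rightarrow>\<^sub>0 nat) \<Rightarrow> nat set \<Rightarrow> nat set \<Rightarrow> (nat \<Rightarrow>\<^sub>0 nat) \<Rightarrow>\<^sub>0 'k::field" where
  "boundary_of_face m A =
     (\<lambda>B. \<Sum>i\<in>A. face_sign i A * monomial (lcm_label m A - lcm_label m (A - {i})) *
                  face_basis (A - {i}) B)"

definition boundary ::
    "nat set set \<Rightarrow> (nat \<Rightarrow> nat \<Rightarrow>\<^sub>0 nat) \<Rightarrow>
       (nat set \<Rightarrow> (nat \<Rightarrow>\<^sub>0 nat) \<Rightarrow>\<^sub>0 'k::field) \<Rightarrow> nat set \<Rightarrow> (nat \<Rightarrow>\<^sub>0 nat) \<Rightarrow>\<^sub>0 'k" where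
  "boundary \<Delta> m f = (\<lambda>B. \<Sum>A\<in>\<Delta>. f A * boundary_of_face m A B)"

definition supports_minimal_resolution ::
    "nat \<Rightarrow> nat set set \<Rightarrow> (nat \<Rightarrow> nat \<Rightarrow>\<^sub>0 nat) \<Rightarrow> ((nat \<Rightarrow>\<^sub>0 nat) \<Rightarrow>\<^sub>0 'k::field) set \<Rightarrow> bool" where
  "supports_minimal_resolution N \<Delta> m I \<longleftrightarrow>
     minimal_free_resolution N (face_module N \<Delta>) (\<lambda>_. boundary \<Delta> m)
       (quotient_module (poly_ring N) I)"

end

theory Submission
  imports Defs
begin

text \<open>
  Take one variable for every face of \<open>\<Delta>\<close> and let the generator of a vertex be the product of the
  variables of all faces avoiding it. The label \<open>m\<^sub>A\<close> is then the product of the variables of the faces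
  not containing \<open>A\<close>. It determines \<open>A\<close> when \<open>A\<close> is a face, while all non-faces share one label.
  The faces whose label divides a given monomial form \<open>\<Delta>\<close> or a full simplex (an intersection of
  faces, empty exactly when the monomial is not in the ideal). So the labelled complex is a resolution as soon as \<open>\<Delta>\<close> is acyclic, and a tree is acyclic
  by Mayer-Vietoris: removing a leaf \<open>F\<close> with joint \<open>G\<close> leaves a tree meeting \<open>F\<close> in the nonempty
  simplex \<open>F \<inter> G\<close>. Acyclicity also excludes the boundary of a simplex, so there is never exactly one
  non-face, whose label would be unique.
\<close>

section \<open>Acyclicity of simplicial trees\<close>

text \<open>The empty set counts as a face throughout, so exactness means vanishing of reduced
  homology. This shapes two places. The complex consisting of the empty face alone is not acyclic,
  hence a leaf may be split off only if it meets its joint, which is what connectedness provides;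
  and a multidegree below which only the empty face lies has to be handled apart. One variable per
  facet would be too coarse: for a single simplex every label would then be 1. With one variable per
  face, the variable of \<open>A\<close> itself already forces a set with the same label as
  \<open>A\<close> to lie inside \<open>A\<close>. Signs refer to an order of the vertices, so the
  complex is carried over to the indices \<open>{1..n}\<close>. Acyclicity is proved for chains of
  all dimensions at once; the homological degree returns only in the resolution, by cutting a
  filling down to the faces of the right size.\<close>

definition chains_on :: "'v set set \<Rightarrow> ('v set \<Rightarrow> 'a::comm_ring_1) set" where
  "chains_on D = {c. \<forall>A. A \<notin> D \<longrightarrow> c A = 0}"

text \<open>The usual simplicial boundary, read off at the coefficient of \<open>B\<close>: the
  faces with \<open>B\<close> in their boundary are the sets \<open>insert j B\<close>. The sign may
  be computed in \<open>B\<close> instead of \<open>insert j B\<close>, because \<open>j\<close> is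
  not smaller than itself.\<close>

definition chain_boundary :: "nat set \<Rightarrow> (nat set \<Rightarrow> 'a::comm_ring_1) \<Rightarrow> nat set \<Rightarrow> 'a" where
  "chain_boundary U c B = (\<Sum>j\<in>U - B. face_sign j B * c (insert j B))"

text \<open>Chains mix faces of all sizes, the empty face included. For a complex that is exactly
  \<open>{{}}\<close> the property fails: the unit chain at \<open>{}\<close> is a cycle but no
  boundary.\<close>

definition exact_chains :: "nat set \<Rightarrow> (nat set \<Rightarrow> 'a::comm_ring_1) set \<Rightarrow> bool" where
  "exact_chains U C \<longleftrightarrow> (\<forall>c\<in>C. chain_boundary U c = (\<lambda>_. 0) \<longrightarrow> c \<in> chain_boundary U ` C)"

definition down_closed :: "'v set set \<Rightarrow> bool" where
  "down_closed D \<longleftrightarrow> (\<forall>A\<in>D. \<forall>B. B \<subseteq> A \<longrightarrow> B \<in> D)"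

lemma down_closedD: "down_closed D \<Longrightarrow> A \<in> D \<Longrightarrow> B \<subseteq> A \<Longrightarrow> B \<in> D"
  unfolding down_closed_def by blast

lemma chains_onI: "(\<And>A. A \<notin> D \<Longrightarrow> c A = 0) \<Longrightarrow> c \<in> chains_on D"
  by (simp add: chains_on_def)

lemma chains_onD: "c \<in> chains_on D \<Longrightarrow> A \<notin> D \<Longrightarrow> c A = 0"
  by (simp add: chains_on_def)

lemma chain_boundary_add:
  "chain_boundary U (\<lambda>A. c A + d A) B = chain_boundary U c B + chain_boundary U d B"
  by (simp add: chain_boundary_def distrib_left sum.distrib)

lemma chain_boundary_diff:
  "chain_boundary U (\<lambda>A. c A - d A) B = chain_boundary U c B - chain_boundary U d B"
  by (simp add: chain_boundary_def right_diff_distrib sum_subtractf)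

lemma chain_boundary_in_chains:
  assumes "down_closed D" "c \<in> chains_on D"
  shows "chain_boundary U c \<in> chains_on D"
proof (rule chains_onI)
  fix B assume "B \<notin> D"
  then have "c (insert j B) = 0" for j
    using assms by (meson chains_onD down_closedD subset_insertI)
  then show "chain_boundary U c B = 0"
    by (simp add: chain_boundary_def)
qed

lemma face_sign_insert_self: "face_sign j (insert j B) = face_sign j B"
proof -
  have "{i \<in> insert j B. i < j} = {i \<in> B. i < j}" by auto
  then show ?thesis by (simp add: face_sign_def)
qed

text \<open>A new element shifts the position of \<open>j\<close> by one exactly when it is smaller
  than \<open>j\<close>. This asymmetry in \<open>i\<close> and \<open>j\<close> produces the
  cancellation in the square of the boundary.\<close>

lemma face_sign_insert:
  assumes "i \<notin> B" "i \<noteq> j"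
  shows "(face_sign j (insert i B) :: 'a::comm_ring_1)
           = (if i < j then - face_sign j B else face_sign j B)"
proof (cases "i < j")
  case True
  then have "{l \<in> insert i B. l < j} = insert i {l \<in> B. l < j}" by auto
  moreover have "finite {l \<in> B. l < j}" by (rule finite_subset[of _ "{..<j}"]) auto
  ultimately show ?thesis using True assms by (simp add: face_sign_def)
next
  case False
  then have "{l \<in> insert i B. l < j} = {l \<in> B. l < j}" by auto
  then show ?thesis using False by (simp add: face_sign_def)
qed

lemma chain_boundary_boundary:
  fixes c :: "nat set \<Rightarrow> 'a::comm_ring_1"
  assumes "finite U"
  shows "chain_boundary U (chain_boundary U c) B = 0"
proof -
  define X where "X = U - B"
  define g where "g = (\<lambda>j i. face_sign j B * face_sign i (insert j B) * c (insert i (insert j B)))"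
  have fX: "finite X" using assms by (simp add: X_def)
  have "chain_boundary U (chain_boundary U c) B = (\<Sum>j\<in>X. \<Sum>i\<in>X - {j}. g j i)"
    unfolding chain_boundary_def X_def g_def sum_distrib_left mult.assoc
    by (intro sum.cong) auto
  also have "\<dots> = (\<Sum>j\<in>X. (\<Sum>i\<in>{i\<in>X. j < i}. g j i) + (\<Sum>i\<in>{i\<in>X. i < j}. g j i))"
  proof (rule sum.cong[OF refl])
    fix j assume "j \<in> X"
    have split: "X - {j} = {i\<in>X. j < i} \<union> {i\<in>X. i < j}" by auto
    show "(\<Sum>i\<in>X - {j}. g j i) = (\<Sum>i\<in>{i\<in>X. j < i}. g j i) + (\<Sum>i\<in>{i\<in>X. i < j}. g j i)"
      unfolding split using fX by (intro sum.union_disjoint) auto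
  qed
  also have "\<dots> = (\<Sum>j\<in>X. \<Sum>i\<in>{i\<in>X. j < i}. g j i) + (\<Sum>j\<in>X. \<Sum>i\<in>{i\<in>X. i < j}. g j i)"
    by (rule sum.distrib)
  \<comment> \<open>Both halves are brought to pairs with the smaller element named first; swapping
    the order of insertion then costs exactly one sign.\<close>
  also have "(\<Sum>j\<in>X. \<Sum>i\<in>{i\<in>X. i < j}. g j i) = (\<Sum>i\<in>X. \<Sum>j\<in>{j\<in>X. i < j}. g j i)"
    by (rule sum.swap_restrict[OF fX fX])
  also have "\<dots> = (\<Sum>i\<in>X. \<Sum>j\<in>{j\<in>X. i < j}. - g i j)"
  proof (intro sum.cong refl)
    fix i j assume "i \<in> X" "j \<in> {j\<in>X. i < j}"
    then have "i \<notin> B" "j \<notin> B" "i < j" by (auto simp: X_def)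
    then have "(face_sign j (insert i B) :: 'a) = - face_sign j B"
      "(face_sign i (insert j B) :: 'a) = face_sign i B"
      by (simp_all add: face_sign_insert)
    then show "g j i = - g i j"
      unfolding g_def insert_commute[of j i] by simp
  qed
  also have "(\<Sum>j\<in>X. \<Sum>i\<in>{i\<in>X. j < i}. g j i) + \<dots> = 0"
    by (simp add: sum_negf)
  finally show ?thesis .
qed

text \<open>A simplex is a cone over any of its vertices, and coning a cycle fills it. Taking the
  smallest vertex as apex puts it in first position: its own sign is 1, and the sign of every other
  vertex of \<open>W\<close> flips when the apex is added.\<close>

lemma exact_chains_Pow:
  assumes "finite U" "W \<subseteq> U" "W \<noteq> {}"
  shows "exact_chains U (chains_on (Pow W) :: (nat set \<Rightarrow> 'a::comm_ring_1) set)"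
  unfolding exact_chains_def
proof (intro ballI impI)
  fix c :: "nat set \<Rightarrow> 'a"
  assume c: "c \<in> chains_on (Pow W)" and cyc: "chain_boundary U c = (\<lambda>_. 0)"
  define w where "w = Min W"
  have fW: "finite W" using assms finite_subset by blast
  have w: "w \<in> W" "w \<in> U" "\<And>j. j \<in> W \<Longrightarrow> w \<le> j"
    using Min_in[OF fW assms(3)] Min_le[OF fW] assms(2) unfolding w_def by blast+
  \<comment> \<open>The cone over the part of \<open>c\<close> that avoids the apex
    \<open>w\<close>; the remaining coefficients of \<open>c\<close> are recovered from the cycle
    condition.\<close>
  define h where "h = (\<lambda>B. if w \<in> B then c (B - {w}) else 0)"
  \<comment> \<open>If \<open>B'\<close> lies in \<open>W\<close>, nothing in \<open>B\<close> is
    smaller than \<open>w\<close>; otherwise \<open>c B'\<close> is zero and the sign does not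
    matter.\<close>
  have sign_w: "face_sign w B * c B' = c B'" if "B \<subseteq> insert w B'" for B B'
  proof (cases "B' \<subseteq> W")
    case True
    then have "{j \<in> B. j < w} = {}" using that w by force
    then show ?thesis by (simp only: face_sign_def) simp
  qed (use c chains_onD in force)
  have h: "h \<in> chains_on (Pow W)"
  proof (rule chains_onI)
    fix A assume "A \<notin> Pow W"
    then have "w \<in> A \<Longrightarrow> A - {w} \<notin> Pow W" using w by blast
    then show "h A = 0" using chains_onD[OF c] unfolding h_def by presburger
  qed
  have "chain_boundary U h B = c B" for B
  proof (cases "w \<in> B")
    case False
    have "chain_boundary U h B = (\<Sum>j\<in>U - B. if j = w then face_sign w B * c B else 0)"
      unfolding chain_boundary_def using False by (intro sum.cong) (auto simp: h_def)
    also have "\<dots> = c B"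
      using False assms w sign_w[of B B] by (simp add: subset_insertI)
    finally show ?thesis .
  next
    case True
    \<comment> \<open>The cycle condition at \<open>B'\<close> expresses \<open>c B\<close> through
      coefficients on faces avoiding \<open>w\<close>, and those are the values of the cone
      \<open>h\<close>.\<close>
    define B' where "B' = B - {w}"
    have B: "B = insert w B'" "w \<notin> B'" using True by (auto simp: B'_def)
    have "0 = chain_boundary U c B'" using cyc by simp
    also have "\<dots> = (\<Sum>j\<in>insert w (U - B). face_sign j B' * c (insert j B'))"
      unfolding chain_boundary_def using B w by (intro sum.cong) auto
    also have "\<dots> = face_sign w B' * c B + (\<Sum>j\<in>U - B. face_sign j B' * c (insert j B'))"
      using assms True by (subst sum.insert) (auto simp: B)
    also have "(\<Sum>j\<in>U - B. face_sign j B' * c (insert j B'))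
                 = (\<Sum>j\<in>U - B. - (face_sign j B * h (insert j B)))"
    proof (rule sum.cong[OF refl])
      fix j assume j: "j \<in> U - B"
      then have eq: "insert j B - {w} = insert j B'" using B by auto
      show "face_sign j B' * c (insert j B') = - (face_sign j B * h (insert j B))"
      proof (cases "j \<in> W")
        case True
        then have "w < j" using j w B by (metis DiffD2 insertI1 le_neq_implies_less)
        then show ?thesis using B eq by (simp add: h_def face_sign_insert)
      next
        case False
        then show ?thesis using c eq B by (auto simp: h_def chains_on_def)
      qed
    qed
    also have "\<dots> = - chain_boundary U h B"
      by (simp add: chain_boundary_def sum_negf)
    also have "face_sign w B' * c B = c B"
      using sign_w[of B' B] by (auto simp: B'_def)
    finally show ?thesis by (simp add: add_eq_0_iff)
  qed
  then show "c \<in> chain_boundary U ` chains_on (Pow W)"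
    using h by (intro image_eqI[of _ _ h]) auto
qed

text \<open>Mayer-Vietoris by hand. Split a cycle as \<open>p + q\<close> with \<open>p\<close> on
  \<open>D\<close> and \<open>q\<close> on \<open>E\<close>. The boundaries of \<open>p\<close> and
  \<open>q\<close> are opposite, so that of \<open>p\<close> is a cycle on the intersection and
  equals the boundary of some \<open>e\<close> there. Then \<open>p - e\<close> and
  \<open>q + e\<close> are cycles on \<open>D\<close> and on \<open>E\<close>, and their fillings
  add up to a filling of the original cycle.\<close>

lemma exact_chains_Un:
  assumes "finite U" "down_closed D" "down_closed E"
    and D: "exact_chains U (chains_on D :: (nat set \<Rightarrow> 'a::comm_ring_1) set)"
    and E: "exact_chains U (chains_on E :: (nat set \<Rightarrow> 'a) set)"
    and DE: "exact_chains U (chains_on (D \<inter> E) :: (nat set \<Rightarrow> 'a) set)"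
  shows "exact_chains U (chains_on (D \<union> E) :: (nat set \<Rightarrow> 'a) set)"
  unfolding exact_chains_def
proof (intro ballI impI)
  fix c :: "nat set \<Rightarrow> 'a"
  assume c: "c \<in> chains_on (D \<union> E)" and cyc: "chain_boundary U c = (\<lambda>_. 0)"
  define p where "p = (\<lambda>A. if A \<in> D then c A else 0)"
  define q where "q = (\<lambda>A. if A \<in> D then 0 else c A)"
  have p: "p \<in> chains_on D" and q: "q \<in> chains_on E" and pq: "c = (\<lambda>A. p A + q A)"
    using c by (auto simp: p_def q_def chains_on_def)
  have sum0: "chain_boundary U p B + chain_boundary U q B = 0" for B
    using cyc chain_boundary_add[of U p q B] by (simp add: pq)
  have "chain_boundary U p \<in> chains_on (D \<inter> E)"
  proof (rule chains_onI)
    fix B assume "B \<notin> D \<inter> E"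
    then have "chain_boundary U p B = 0 \<or> chain_boundary U q B = 0"
      using chain_boundary_in_chains[OF assms(2) p] chain_boundary_in_chains[OF assms(3) q] chains_onD
      by (metis IntI)
    then show "chain_boundary U p B = 0" using sum0[of B] by auto
  qed
  moreover have "chain_boundary U (chain_boundary U p) = (\<lambda>_. 0)"
    using assms(1) chain_boundary_boundary by blast
  ultimately obtain e where e: "e \<in> chains_on (D \<inter> E)" "chain_boundary U p = chain_boundary U e"
    using DE unfolding exact_chains_def by blast
  have "(\<lambda>A. p A - e A) \<in> chains_on D" "(\<lambda>A. q A + e A) \<in> chains_on E"
    using p q e by (auto simp: chains_on_def)
  moreover have "chain_boundary U (\<lambda>A. p A - e A) = (\<lambda>_. 0)"
    using e(2) by (auto simp: chain_boundary_diff)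
  moreover have "chain_boundary U (\<lambda>A. q A + e A) = (\<lambda>_. 0)"
    using sum0 unfolding e(2) by (auto simp: chain_boundary_add add.commute)
  ultimately obtain x y where x: "x \<in> chains_on D" "(\<lambda>A. p A - e A) = chain_boundary U x"
    and y: "y \<in> chains_on E" "(\<lambda>A. q A + e A) = chain_boundary U y"
    using D E unfolding exact_chains_def by blast
  have "c A = chain_boundary U (\<lambda>A. x A + y A) A" for A
    using fun_cong[OF x(2), of A] fun_cong[OF y(2), of A]
    by (simp add: chain_boundary_add pq algebra_simps flip: x(2) y(2))
  then have "c = chain_boundary U (\<lambda>A. x A + y A)" by blast
  moreover have "(\<lambda>A. x A + y A) \<in> chains_on (D \<union> E)"
    using x(1) y(1) by (auto simp: chains_on_def)
  ultimately show "c \<in> chain_boundary U ` chains_on (D \<union> E)" by blast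
qed

text \<open>If \<open>A\<close> were the only missing subset, \<open>D\<close> would be the boundary
  of the full simplex, a sphere, and the boundary of the top face would be a cycle on
  \<open>D\<close> without a filling in \<open>D\<close>.\<close>

lemma exact_chains_not_simplex_boundary:
  assumes "finite U" "down_closed D" "D \<subseteq> Pow U" "U \<noteq> {}"
    and D: "exact_chains U (chains_on D :: (nat set \<Rightarrow> 'a::comm_ring_1) set)"
    and A: "A \<subseteq> U" "A \<notin> D"
  shows "\<exists>B\<subseteq>U. B \<noteq> A \<and> B \<notin> D"
proof (rule ccontr)
  assume "\<not> ?thesis"
  then have all: "\<And>B. B \<subseteq> U \<Longrightarrow> B \<noteq> A \<Longrightarrow> B \<in> D" by blast
  \<comment> \<open>Were \<open>U\<close> a face, downward closure would make \<open>A\<close> one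
    as well.\<close>
  have AU: "A = U"
    using all[of U] A down_closedD[OF assms(2)] by blast
  define e :: "nat set \<Rightarrow> 'a" where "e = (\<lambda>B. if B = U then 1 else 0)"
  have "chain_boundary U e \<in> chains_on D"
  proof (rule chains_onI)
    fix B assume "B \<notin> D"
    show "chain_boundary U e B = 0"
    proof (cases "B = U")
      case False
      then have "\<not> B \<subseteq> U" using all \<open>B \<notin> D\<close> AU by blast
      then show ?thesis by (auto simp: chain_boundary_def e_def intro!: sum.neutral)
    qed (simp add: chain_boundary_def)
  qed
  moreover have "chain_boundary U (chain_boundary U e) = (\<lambda>_. 0)"
    using assms(1) chain_boundary_boundary by blast
  ultimately obtain b where b: "b \<in> chains_on D" "chain_boundary U e = chain_boundary U b"
    using D unfolding exact_chains_def by blast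
  have "(\<lambda>B. e B - b B) \<in> chains_on (Pow U)"
    using b(1) assms(3) by (auto simp: chains_on_def e_def)
  moreover have "chain_boundary U (\<lambda>B. e B - b B) = (\<lambda>_. 0)"
    using b(2) by (auto simp: chain_boundary_diff)
  ultimately obtain g where "(\<lambda>B. e B - b B) = chain_boundary U g"
    using exact_chains_Pow[OF assms(1) subset_refl assms(4)] unfolding exact_chains_def by blast
  \<comment> \<open>No vertex is left to add to \<open>U\<close>, so every boundary vanishes there.
    Thus \<open>b\<close> has coefficient 1 at \<open>U\<close>, although \<open>U\<close> is not in
    \<open>D\<close>.\<close>
  from fun_cong[OF this, of U] have "e U = b U"
    by (simp add: chain_boundary_def)
  then show False
    using b(1) A AU by (simp add: chains_on_def e_def)
qed

section \<open>Facets, removal of a leaf, and induction over the facets of a tree\<close>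

lemma facets_generated_complex:
  assumes "\<F> \<subseteq> facets \<Delta>"
  shows "facets (generated_complex \<F>) = \<F>"
proof -
  have anti: "F = G" if "F \<in> \<F>" "G \<in> \<F>" "F \<subseteq> G" for F G
    using that assms unfolding facets_def by blast
  show ?thesis
  proof (intro equalityI subsetI)
    fix F assume F: "F \<in> facets (generated_complex \<F>)"
    then obtain G where G: "G \<in> \<F>" "F \<subseteq> G"
      unfolding facets_def generated_complex_def by blast
    then have "G \<in> generated_complex \<F>" unfolding generated_complex_def by blast
    then show "F \<in> \<F>" using F G unfolding facets_def by blast
  next
    fix F assume F: "F \<in> \<F>"
    have "G = F" if "G \<in> generated_complex \<F>" "F \<subseteq> G" for G
      using that anti F unfolding generated_complex_def by blast
    then show "F \<in> facets (generated_complex \<F>)"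
      using F unfolding facets_def generated_complex_def by blast
  qed
qed

lemma down_closed_generated_complex: "down_closed (generated_complex \<F>)"
  unfolding down_closed_def generated_complex_def by blast

text \<open>Connectedness as the impossibility of splitting the facets into two nonempty families
  with no meeting members. In this form it passes to the family without a leaf, with no chains of
  facets to be rerouted.\<close>

definition chain_connected :: "'v set set \<Rightarrow> bool" where
  "chain_connected \<F> \<longleftrightarrow>
     (\<forall>P Q. \<F> = P \<union> Q \<and> P \<inter> Q = {} \<and> P \<noteq> {} \<and> Q \<noteq> {} \<longrightarrow> (\<exists>F\<in>P. \<exists>G\<in>Q. F \<inter> G \<noteq> {}))"

lemma chain_connectedD:
  assumes "chain_connected \<F>" "\<F> = P \<union> Q" "P \<inter> Q = {}" "P \<noteq> {}" "Q \<noteq> {}"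
  shows "\<exists>F\<in>P. \<exists>G\<in>Q. F \<inter> G \<noteq> {}"
  using assms unfolding chain_connected_def by blast

text \<open>A chain of facets that starts in \<open>P\<close> and ends in \<open>Q\<close> has a
  step that crosses over.\<close>

lemma connected_complex_chain_connected:
  assumes "connected_complex \<Delta>"
  shows "chain_connected (facets \<Delta>)"
  unfolding chain_connected_def
proof (intro allI impI)
  fix P Q assume PQ: "facets \<Delta> = P \<union> Q \<and> P \<inter> Q = {} \<and> P \<noteq> {} \<and> Q \<noteq> {}"
  then obtain F G where FG: "F \<in> P" "G \<in> Q" by blast
  then have "(F, G) \<in> {(A, B). A \<in> facets \<Delta> \<and> B \<in> facets \<Delta> \<and> A \<inter> B \<noteq> {}}\<^sup>*"
    using assms PQ unfolding connected_complex_def by blast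
  then have "G \<in> P \<or> (\<exists>F\<in>P. \<exists>G\<in>Q. F \<inter> G \<noteq> {})"
    by (induction rule: rtrancl_induct) (use FG PQ in blast)+
  then show "\<exists>F\<in>P. \<exists>G\<in>Q. F \<inter> G \<noteq> {}" using FG PQ by blast
qed

text \<open>The joint \<open>G\<close> stands in for the leaf \<open>F\<close>: whatever meets
  \<open>F\<close> meets it inside \<open>G\<close>. So \<open>F\<close> meets \<open>G\<close> as
  soon as it meets anything, and a crossing that uses \<open>F\<close> can be replaced by one that
  uses \<open>G\<close>, once \<open>F\<close> is put on the side of \<open>G\<close>.\<close>

lemma chain_connected_remove_leaf:
  assumes conn: "chain_connected \<F>" and F: "F \<in> \<F>" and G: "G \<in> \<F>" "G \<noteq> F"
    and leaf: "\<And>H. H \<in> \<F> \<Longrightarrow> H \<noteq> F \<Longrightarrow> F \<inter> H \<subseteq> G"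
  shows "F \<inter> G \<noteq> {}" and "chain_connected (\<F> - {F})"
proof -
  have "\<F> = {F} \<union> (\<F> - {F})" "\<F> - {F} \<noteq> {}"
    using F G by auto
  from chain_connectedD[OF conn this(1) _ _ this(2)]
  obtain H where "H \<in> \<F> - {F}" "F \<inter> H \<noteq> {}" by blast
  then show "F \<inter> G \<noteq> {}" using leaf[of H] by blast
  have side: "\<exists>A\<in>P. \<exists>B\<in>Q. A \<inter> B \<noteq> {}"
    if PQ: "\<F> - {F} = P \<union> Q" "P \<inter> Q = {}" "Q \<noteq> {}" and GP: "G \<in> P" for P Q
  proof -
    have "\<F> = insert F P \<union> Q" "insert F P \<inter> Q = {}"
      using PQ F by auto
    from chain_connectedD[OF conn this _ PQ(3)]
    obtain A B where AB: "A \<in> insert F P" "B \<in> Q" "A \<inter> B \<noteq> {}" by blast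
    show ?thesis
    proof (cases "A = F")
      case True
      then have "F \<inter> B \<subseteq> G" using leaf[of B] AB PQ by blast
      then show ?thesis using True AB GP by blast
    qed (use AB in blast)
  qed
  show "chain_connected (\<F> - {F})"
    unfolding chain_connected_def
  proof (intro allI impI)
    fix P Q assume PQ: "\<F> - {F} = P \<union> Q \<and> P \<inter> Q = {} \<and> P \<noteq> {} \<and> Q \<noteq> {}"
    then consider "G \<in> P" | "G \<in> Q" using G by blast
    then show "\<exists>A\<in>P. \<exists>B\<in>Q. A \<inter> B \<noteq> {}"
    proof cases
      case 2
      then have "\<exists>A\<in>Q. \<exists>B\<in>P. A \<inter> B \<noteq> {}" using side[of Q P] PQ by blast
      then show ?thesis by (metis Int_commute)
    qed (use side[of P Q] PQ in blast)
  qed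
qed

text \<open>Boundary signs need numbered vertices, while \<open>\<Delta>\<close> lives on an
  arbitrary type. Preimages respect unions and intersections, so Mayer-Vietoris decompositions of
  \<open>\<Delta>\<close> carry over to the indices.\<close>

definition pullback_complex :: "(nat \<Rightarrow> 'v) \<Rightarrow> nat set \<Rightarrow> 'v set set \<Rightarrow> nat set set" where
  "pullback_complex v U \<Delta> = {A. A \<subseteq> U \<and> v ` A \<in> \<Delta>}"

lemma pullback_complex_Int:
  "pullback_complex v U (\<Gamma> \<inter> \<Delta>) = pullback_complex v U \<Gamma> \<inter> pullback_complex v U \<Delta>"
  by (auto simp: pullback_complex_def)

lemma pullback_complex_Un:
  "pullback_complex v U (\<Gamma> \<union> \<Delta>) = pullback_complex v U \<Gamma> \<union> pullback_complex v U \<Delta>"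
  by (auto simp: pullback_complex_def)

lemma down_closed_pullback_complex:
  "down_closed \<Delta> \<Longrightarrow> down_closed (pullback_complex v U \<Delta>)"
  unfolding down_closed_def pullback_complex_def by (blast dest: image_mono)

lemma exact_chains_pullback_simplex:
  assumes "finite U" "v ` U = V" "F \<subseteq> V" "F \<noteq> {}"
  shows "exact_chains U (chains_on (pullback_complex v U (Pow F)) :: (nat set \<Rightarrow> 'a::comm_ring_1) set)"
proof -
  have "pullback_complex v U (Pow F) = Pow {i \<in> U. v i \<in> F}"
    unfolding pullback_complex_def by auto
  moreover have "{i \<in> U. v i \<in> F} \<noteq> {}" using assms by blast
  ultimately show ?thesis using exact_chains_Pow[OF assms(1), of "{i \<in> U. v i \<in> F}"] by auto
qed

text \<open>The hypotheses speak of all subfamilies of \<open>\<F>\<close> and of facets of one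
  fixed \<open>\<Delta>\<close>, so they survive the removal of a leaf and the induction on
  \<open>\<F>\<close> goes through.\<close>

lemma exact_chains_forest:
  assumes U: "finite U" "v ` U = V"
    and fin: "finite \<F>"
    and leaves: "\<And>\<G>. \<G> \<subseteq> \<F> \<Longrightarrow> \<G> \<noteq> {} \<Longrightarrow> \<exists>F. leaf (generated_complex \<G>) F"
    and sub: "\<F> \<subseteq> facets \<Delta>" "\<F> \<noteq> {}" and FV: "\<And>F. F \<in> \<F> \<Longrightarrow> F \<subseteq> V \<and> F \<noteq> {}"
    and conn: "chain_connected \<F>"
  shows "exact_chains U (chains_on (pullback_complex v U (generated_complex \<F>))
           :: (nat set \<Rightarrow> 'a::comm_ring_1) set)"
  using fin leaves sub FV conn
proof (induction \<F> rule: finite_psubset_induct)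
  case (psubset \<F>)
  have fac: "facets (generated_complex \<F>) = \<F>"
    using psubset.prems by (intro facets_generated_complex)
  obtain F where F: "leaf (generated_complex \<F>) F" using psubset.prems(1)[of \<F>] psubset.prems by blast
  then have FF: "F \<in> \<F>" unfolding leaf_def fac by blast
  show ?case
  proof (cases "\<F> = {F}")
    case True
    then have "generated_complex \<F> = Pow F" unfolding generated_complex_def by auto
    then show ?thesis using exact_chains_pullback_simplex[OF U] psubset.prems(4)[OF FF] by auto
  next
    case False
    then obtain G where G: "G \<in> \<F>" "G \<noteq> F" "\<And>H. H \<in> \<F> \<Longrightarrow> H \<noteq> F \<Longrightarrow> F \<inter> H \<subseteq> G"
      using F unfolding leaf_def fac by blast
    define D where "D = pullback_complex v U (generated_complex (\<F> - {F}))"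
    define E where "E = pullback_complex v U (Pow F)"
    have D_exact: "exact_chains U (chains_on D :: (nat set \<Rightarrow> 'a) set)"
      unfolding D_def
    proof (rule psubset.IH)
      show "\<F> - {F} \<subset> \<F>" using FF by blast
      show "\<exists>F. leaf (generated_complex \<G>) F" if "\<G> \<subseteq> \<F> - {F}" "\<G> \<noteq> {}" for \<G>
        using that psubset.prems(1)[of \<G>] by blast
      show "chain_connected (\<F> - {F})"
        using chain_connected_remove_leaf(2)[OF psubset.prems(5) FF G] .
      show "\<F> - {F} \<subseteq> facets \<Delta>" using psubset.prems(2) by blast
      show "\<F> - {F} \<noteq> {}" using G by blast
      show "H \<subseteq> V \<and> H \<noteq> {}" if "H \<in> \<F> - {F}" for H using that psubset.prems(4) by blast
    qed
    have E_exact: "exact_chains U (chains_on E :: (nat set \<Rightarrow> 'a) set)"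
      unfolding E_def using exact_chains_pullback_simplex[OF U] psubset.prems(4)[OF FF] by auto
    have DE_exact: "exact_chains U (chains_on (D \<inter> E) :: (nat set \<Rightarrow> 'a) set)"
    proof -
      \<comment> \<open>A face shared by \<open>F\<close> and another facet lies in the joint;
        conversely \<open>G\<close> stays in the family, so the overlap is all of
        \<open>Pow (F \<inter> G)\<close>.\<close>
      have "A \<subseteq> G" if "A \<subseteq> F" "A \<subseteq> H" "H \<in> \<F> - {F}" for A H
        using that G(3)[of H] by blast
      then have "generated_complex (\<F> - {F}) \<inter> Pow F = Pow (F \<inter> G)"
        using G(1,2) unfolding generated_complex_def by auto
      then have "D \<inter> E = pullback_complex v U (Pow (F \<inter> G))"
        unfolding D_def E_def by (metis pullback_complex_Int)
      then show ?thesis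
        using exact_chains_pullback_simplex[OF U, of "F \<inter> G"] psubset.prems(4)[OF FF]
          chain_connected_remove_leaf(1)[OF psubset.prems(5) FF G] by auto
    qed
    have "down_closed D" "down_closed E"
      unfolding D_def E_def
      by (intro down_closed_pullback_complex down_closed_generated_complex)
        (intro down_closed_pullback_complex, unfold down_closed_def, blast)
    then have "exact_chains U (chains_on (D \<union> E) :: (nat set \<Rightarrow> 'a) set)"
      using exact_chains_Un[OF U(1) _ _ D_exact E_exact DE_exact] by blast
    moreover have "generated_complex \<F> = generated_complex (\<F> - {F}) \<union> Pow F"
      using FF unfolding generated_complex_def by auto
    then have "pullback_complex v U (generated_complex \<F>) = D \<union> E"
      unfolding D_def E_def by (metis pullback_complex_Un)
    ultimately show ?thesis by simp
  qed
qed

lemma generated_complex_facets: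
  assumes "finite \<Delta>" "down_closed \<Delta>"
  shows "generated_complex (facets \<Delta>) = \<Delta>"
proof -
  have "\<exists>F\<in>facets \<Delta>. A \<subseteq> F" if A: "A \<in> \<Delta>" for A
  proof -
    obtain F where "F \<in> \<Delta>" "A \<subseteq> F" "\<forall>G\<in>\<Delta>. F \<subseteq> G \<longrightarrow> F = G"
      using finite_has_maximal2[OF assms(1) A] by blast
    then show ?thesis by (auto simp: facets_def)
  qed
  moreover have "A \<in> \<Delta>" if "A \<subseteq> F" "F \<in> facets \<Delta>" for A F
    using that down_closedD[OF assms(2), of F A] by (simp add: facets_def)
  ultimately show ?thesis by (auto simp: generated_complex_def)
qed

lemma exact_chains_tree:
  assumes tree: "simplicial_tree V \<Delta>" and U: "finite U" "v ` U = V"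
  shows "exact_chains U (chains_on (pullback_complex v U \<Delta>) :: (nat set \<Rightarrow> 'a::comm_ring_1) set)"
proof -
  have cx: "finite V" "V \<noteq> {}" "\<Delta> \<subseteq> Pow V" "down_closed \<Delta>" "\<And>v. v \<in> V \<Longrightarrow> {v} \<in> \<Delta>"
    using tree unfolding simplicial_tree_def simplicial_complex_def down_closed_def by auto
  then have fin: "finite \<Delta>" using finite_subset by blast
  have gen: "generated_complex (facets \<Delta>) = \<Delta>" using generated_complex_facets fin cx by blast
  have "exact_chains U (chains_on (pullback_complex v U (generated_complex (facets \<Delta>)))
           :: (nat set \<Rightarrow> 'a) set)"
  proof (rule exact_chains_forest[OF U])
    show "finite (facets \<Delta>)" using fin by (simp add: facets_def)
    show "facets \<Delta> \<noteq> {}" using gen cx unfolding generated_complex_def by blast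
    show "F \<subseteq> V \<and> F \<noteq> {}" if "F \<in> facets \<Delta>" for F
      using that cx unfolding facets_def by blast
    show "chain_connected (facets \<Delta>)"
      using tree connected_complex_chain_connected unfolding simplicial_tree_def by blast
    show "\<exists>F. leaf (generated_complex \<G>) F" if "\<G> \<subseteq> facets \<Delta>" "\<G> \<noteq> {}" for \<G>
      using that tree unfolding simplicial_tree_def by blast
  qed (rule subset_refl)
  then show ?thesis by (simp add: gen)
qed

section \<open>Labelled complexes in fixed multidegrees\<close>

definition divides :: "(nat \<Rightarrow>\<^sub>0 nat) \<Rightarrow> (nat \<Rightarrow>\<^sub>0 nat) \<Rightarrow> bool" where
  "divides s t \<longleftrightarrow> (\<forall>x. Poly_Mapping.lookup s x \<le> Poly_Mapping.lookup t x)"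

lemma divides_refl: "divides s s"
  by (simp add: divides_def)

lemma divides_trans: "divides s t \<Longrightarrow> divides t u \<Longrightarrow> divides s u"
  unfolding divides_def using le_trans by blast

lemma divides_add_left: "divides s (s + t)"
  by (simp add: divides_def lookup_add)

lemma divides_add_diff: "divides s t \<Longrightarrow> s + (t - s) = t"
  by (intro poly_mapping_eqI) (simp add: divides_def lookup_add lookup_minus)

text \<open>In monomials: \<open>u/t\<close> times \<open>t/s\<close> is \<open>u/s\<close>. This is
  what makes the differential homogeneous.\<close>

lemma divides_diff_split: "divides s t \<Longrightarrow> divides t u \<Longrightarrow> (u - t) + (t - s) = u - s"
  by (intro poly_mapping_eqI) (simp add: divides_def lookup_add lookup_minus)

lemma divides_lcm_label_mono:
  assumes "finite A" "B \<subseteq> A"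
  shows "divides (lcm_label m B) (lcm_label m A)"
proof -
  have "finite B" using assms finite_subset by blast
  moreover have "insert 0 ((\<lambda>i. Poly_Mapping.lookup (m i) x) ` B)
                   \<subseteq> insert 0 ((\<lambda>i. Poly_Mapping.lookup (m i) x) ` A)" for x
    using assms by blast
  ultimately show ?thesis
    unfolding divides_def using assms by (auto simp: lookup_lcm_label simp del: Max_insert intro!: Max_mono)
qed

lemma lcm_label_empty: "lcm_label m {} = 0"
  by (intro poly_mapping_eqI) (simp add: lookup_lcm_label)

lemma lcm_label_singleton: "lcm_label m {i} = m i"
  by (intro poly_mapping_eqI) (simp add: lookup_lcm_label)

lemma zero_in_monomials: "0 \<in> monomials N"
  by (simp add: monomials_def)

lemma add_in_monomials: "s \<in> monomials N \<Longrightarrow> t \<in> monomials N \<Longrightarrow> s + t \<in> monomials N"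
  unfolding monomials_def using Poly_Mapping.keys_add[of s t] by blast

lemma diff_in_monomials: "t \<in> monomials N \<Longrightarrow> t - s \<in> monomials N"
  unfolding monomials_def by (auto simp: in_keys_iff lookup_minus subset_iff)

lemma lcm_label_in_monomials:
  assumes "finite A" "\<And>i. i \<in> A \<Longrightarrow> m i \<in> monomials N"
  shows "lcm_label m A \<in> monomials N"
proof -
  have "Poly_Mapping.lookup (lcm_label m A) x = 0" if "\<not> x < N" for x
  proof -
    have "Poly_Mapping.lookup (m i) x = 0" if "i \<in> A" for i
      using assms(2)[OF that] \<open>\<not> x < N\<close> unfolding monomials_def by (auto simp: in_keys_iff)
    then have "insert 0 ((\<lambda>i. Poly_Mapping.lookup (m i) x) ` A) = {0}" by auto
    then show ?thesis by (simp only: lookup_lcm_label[OF assms(1)] Max_singleton)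
  qed
  then show ?thesis unfolding monomials_def by (auto simp: in_keys_iff)
qed

lemma carrier_poly_ring: "p \<in> carrier (poly_ring N) \<longleftrightarrow> Poly_Mapping.keys p \<subseteq> monomials N"
  by (simp add: poly_ring_def)

lemma poly_ring_simps [simp]:
  "mult (poly_ring N) = (*)" "one (poly_ring N) = 1" "zero (poly_ring N) = 0"
  "add (poly_ring N) = (+)"
  by (simp_all add: poly_ring_def)

lemma single_in_poly_ring: "t \<in> monomials N \<Longrightarrow> Poly_Mapping.single t a \<in> carrier (poly_ring N)"
  by (simp add: carrier_poly_ring)

lemma monomial_in_poly_ring: "t \<in> monomials N \<Longrightarrow> monomial t \<in> carrier (poly_ring N)"
  by (simp add: monomial_def single_in_poly_ring)

lemma zero_in_poly_ring: "0 \<in> carrier (poly_ring N)"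
  by (simp add: carrier_poly_ring)

lemma one_in_poly_ring: "1 \<in> carrier (poly_ring N)"
  using single_in_poly_ring[OF zero_in_monomials, of 1 N] by simp

lemma add_in_poly_ring:
  "p \<in> carrier (poly_ring N) \<Longrightarrow> q \<in> carrier (poly_ring N) \<Longrightarrow> p + q \<in> carrier (poly_ring N)"
  unfolding carrier_poly_ring using Poly_Mapping.keys_add[of p q] by blast

lemma uminus_in_poly_ring: "p \<in> carrier (poly_ring N) \<Longrightarrow> - p \<in> carrier (poly_ring N)"
  unfolding carrier_poly_ring by (auto simp: in_keys_iff subset_iff)

lemma mult_in_poly_ring:
  "p \<in> carrier (poly_ring N) \<Longrightarrow> q \<in> carrier (poly_ring N) \<Longrightarrow> p * q \<in> carrier (poly_ring N)"
  unfolding carrier_poly_ring using keys_mult[of p q] add_in_monomials by blast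

lemma sum_in_poly_ring:
  "(\<And>i. i \<in> A \<Longrightarrow> f i \<in> carrier (poly_ring N)) \<Longrightarrow> sum f A \<in> carrier (poly_ring N)"
  by (induction A rule: infinite_finite_induct) (simp_all add: zero_in_poly_ring add_in_poly_ring)

text \<open>The sign in the polynomial ring is the constant polynomial of the sign in the field,
  which links the two boundary maps.\<close>

lemma face_sign_single:
  "(face_sign j A :: (nat \<Rightarrow>\<^sub>0 nat) \<Rightarrow>\<^sub>0 'k::field) = Poly_Mapping.single 0 (face_sign j A)"
proof (cases "even (card {i \<in> A. i < j})")
  case True
  then show ?thesis by (simp add: face_sign_def)
next
  case False
  then show ?thesis by (simp add: face_sign_def single_uminus)
qed

lemma face_sign_in_poly_ring: "face_sign j A \<in> carrier (poly_ring N)"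
  by (simp add: face_sign_single single_in_poly_ring zero_in_monomials)

lemma single_sum:
  "Poly_Mapping.single k (\<Sum>i\<in>A. f i) = (\<Sum>i\<in>A. Poly_Mapping.single k (f i))"
  by (induction A rule: infinite_finite_induct) (simp_all add: single_add)

section \<open>Decomposition of the labelled complex into multidegrees\<close>

definition faces_below ::
    "nat set set \<Rightarrow> (nat \<Rightarrow> nat \<Rightarrow>\<^sub>0 nat) \<Rightarrow> (nat \<Rightarrow>\<^sub>0 nat) \<Rightarrow> nat set set" where
  "faces_below D m t = {A \<in> D. divides (lcm_label m A) t}"

text \<open>The basis element of \<open>A\<close> is given multidegree \<open>m_A\<close>, so a
  homogeneous element of multidegree \<open>t\<close> has a scalar multiple of the monomial
  \<open>t/m_A\<close> as its coefficient at \<open>A\<close>. Subtraction of exponents truncates,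
  so this is meaningful for chains supported on \<open>faces_below\<close>.\<close>

definition lift_chain ::
    "(nat \<Rightarrow> nat \<Rightarrow>\<^sub>0 nat) \<Rightarrow> (nat \<Rightarrow>\<^sub>0 nat) \<Rightarrow> (nat set \<Rightarrow> 'k) \<Rightarrow>
       nat set \<Rightarrow> (nat \<Rightarrow>\<^sub>0 nat) \<Rightarrow>\<^sub>0 'k::field" where
  "lift_chain m t b A = Poly_Mapping.single (t - lcm_label m A) (b A)"

text \<open>The scalars of the component of multidegree \<open>t\<close>. The guard is essential: if
  \<open>m_A\<close> does not divide \<open>t\<close>, the truncated difference would pick up a
  coefficient from another multidegree.\<close>

definition graded_part ::
    "(nat \<Rightarrow> nat \<Rightarrow>\<^sub>0 nat) \<Rightarrow> (nat \<Rightarrow>\<^sub>0 nat) \<Rightarrow> (nat set \<Rightarrow> (nat \<Rightarrow>\<^sub>0 nat) \<Rightarrow>\<^sub>0 'k) \<Rightarrow>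
       nat set \<Rightarrow> 'k::field" where
  "graded_part m t f A =
     (if divides (lcm_label m A) t then Poly_Mapping.lookup (f A) (t - lcm_label m A) else 0)"

lemma boundary_sum:
  "boundary D m (\<lambda>A. \<Sum>t\<in>T. g t A) B = (\<Sum>t\<in>T. boundary D m (g t) B)"
  unfolding boundary_def sum_distrib_right by (rule sum.swap)

lemma graded_part_sum:
  "graded_part m t (\<lambda>A. \<Sum>s\<in>T. g s A) A = (\<Sum>s\<in>T. graded_part m t (g s) A)"
  by (simp add: graded_part_def lookup_sum)

text \<open>Where the label divides both, \<open>t\<close> is determined by
  \<open>t - lcm_label m A\<close>, so distinct multidegrees do not interfere.\<close>

lemma graded_part_lift_chain:
  assumes "b \<in> chains_on (faces_below D m t)"
  shows "graded_part m t' (lift_chain m t b) A = (if t' = t then b A else 0)"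
proof (cases "b A = 0")
  case False
  then have "divides (lcm_label m A) t"
    using chains_onD[OF assms] by (auto simp: faces_below_def)
  then have "t' = t" if "divides (lcm_label m A) t'" "t - lcm_label m A = t' - lcm_label m A"
    using that divides_add_diff by metis
  then show ?thesis
    using \<open>divides (lcm_label m A) t\<close> by (auto simp: graded_part_def lift_chain_def lookup_single when_def)
qed (simp add: graded_part_def lift_chain_def)

lemma graded_part_in_chains_on:
  "f \<in> chains_on D \<Longrightarrow> graded_part m t f \<in> chains_on (faces_below D m t)"
  by (auto simp: chains_on_def graded_part_def faces_below_def)

text \<open>The multidegrees of the terms of \<open>f\<close>; the finite index set for splitting
  \<open>f\<close> into homogeneous components.\<close>

definition multidegrees ::
    "nat set set \<Rightarrow> (nat \<Rightarrow> nat \<Rightarrow>\<^sub>0 nat) \<Rightarrow> (nat set \<Rightarrow> (nat \<Rightarrow>\<^sub>0 nat) \<Rightarrow>\<^sub>0 'k::field) \<Rightarrow>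
       (nat \<Rightarrow>\<^sub>0 nat) set" where
  "multidegrees D m f = (\<Union>A\<in>D. (\<lambda>u. lcm_label m A + u) ` Poly_Mapping.keys (f A))"

lemma finite_multidegrees: "finite D \<Longrightarrow> finite (multidegrees D m f)"
  by (simp add: multidegrees_def)

text \<open>A term with exponent \<open>u\<close> at \<open>A\<close> belongs to exactly one
  component, the one of multidegree \<open>lcm_label m A + u\<close>.\<close>

lemma sum_graded_parts:
  assumes "finite D" "f \<in> chains_on D"
  shows "f A = (\<Sum>t\<in>multidegrees D m f. lift_chain m t (graded_part m t f) A)"
proof (rule poly_mapping_eqI)
  fix u
  define T where "T = multidegrees D m f"
  have fT: "finite T" using assms finite_multidegrees T_def by blast
  have eq: "Poly_Mapping.lookup (lift_chain m t (graded_part m t f) A) u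
              = (if t = lcm_label m A + u then Poly_Mapping.lookup (f A) u else 0)" for t
  proof (cases "divides (lcm_label m A) t")
    case True
    then have "t - lcm_label m A = u \<longleftrightarrow> t = lcm_label m A + u"
      using divides_add_diff by (metis add_diff_cancel_left')
    then show ?thesis
      using True by (auto simp: lift_chain_def graded_part_def lookup_single when_def)
  next
    case False
    then have "t \<noteq> lcm_label m A + u" using divides_add_left by blast
    then show ?thesis using False by (simp add: lift_chain_def graded_part_def)
  qed
  have "lcm_label m A + u \<in> T" if u: "Poly_Mapping.lookup (f A) u \<noteq> 0"
  proof -
    have "A \<in> D" using u chains_onD[OF assms(2), of A] by (metis lookup_zero)
    moreover have "u \<in> Poly_Mapping.keys (f A)" using u by (simp add: in_keys_iff)
    ultimately show ?thesis unfolding T_def multidegrees_def by blast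
  qed
  then have "Poly_Mapping.lookup (f A) u
      = (\<Sum>t\<in>T. if t = lcm_label m A + u then Poly_Mapping.lookup (f A) u else 0)"
    using fT by auto
  then show "Poly_Mapping.lookup (f A) u
      = Poly_Mapping.lookup (\<Sum>t\<in>multidegrees D m f. lift_chain m t (graded_part m t f) A) u"
    by (simp add: lookup_sum eq T_def)
qed

text \<open>Turns the differential, given on basis elements, into the coefficient form of
  \<open>chain_boundary\<close>, with label quotients as weights.\<close>

lemma boundary_eq:
  assumes "finite U" "D \<subseteq> Pow U" "f \<in> chains_on D"
  shows "boundary D m f B
    = (\<Sum>j\<in>U - B. f (insert j B) * (face_sign j B * monomial (lcm_label m (insert j B) - lcm_label m B)))"
proof -
  define T where
    "T j = f (insert j B) * (face_sign j B * monomial (lcm_label m (insert j B) - lcm_label m B))" for j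
  have "boundary D m f B = (\<Sum>A\<in>Pow U. f A * boundary_of_face m A B)"
    unfolding boundary_def using assms chains_onD by (intro sum.mono_neutral_left) force+
  \<comment> \<open>The coefficient at \<open>B\<close> receives something only from pairs with
    \<open>A = insert j B\<close>; spelling this out as a condition lets the sum over
    \<open>A\<close> collapse after the exchange.\<close>
  also have "\<dots> = (\<Sum>A\<in>Pow U. \<Sum>j\<in>U. if j \<notin> B \<and> A = insert j B then T j else 0)"
  proof (rule sum.cong[OF refl])
    fix A assume A: "A \<in> Pow U"
    have "f A * boundary_of_face m A B
        = (\<Sum>j\<in>A. if j \<notin> B \<and> A = insert j B then T j else 0)"
      unfolding boundary_of_face_def sum_distrib_left
    proof (rule sum.cong[OF refl])
      fix j assume j: "j \<in> A"
      show "f A * (face_sign j A * monomial (lcm_label m A - lcm_label m (A - {j})) * face_basis (A - {j}) B)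
          = (if j \<notin> B \<and> A = insert j B then T j else 0)"
      proof (cases "B = A - {j}")
        case True
        then have "A = insert j B" "j \<notin> B" using j by auto
        then show ?thesis by (simp add: T_def face_basis_def face_sign_insert_self)
      next
        case False
        then have "\<not> (j \<notin> B \<and> A = insert j B)" using j by auto
        then show ?thesis using False by (auto simp: face_basis_def)
      qed
    qed
    also have "\<dots> = (\<Sum>j\<in>U. if j \<notin> B \<and> A = insert j B then T j else 0)"
      using A assms(1) by (intro sum.mono_neutral_left) auto
    finally show "f A * boundary_of_face m A B = \<dots>" .
  qed
  also have "\<dots> = (\<Sum>j\<in>U. \<Sum>A\<in>Pow U. if j \<notin> B \<and> A = insert j B then T j else 0)"
    by (rule sum.swap)
  also have "\<dots> = (\<Sum>j\<in>U. if j \<notin> B then T j else 0)"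
  proof (rule sum.cong[OF refl])
    fix j assume "j \<in> U"
    have "T j = 0" if "insert j B \<notin> Pow U"
      using that assms(2) chains_onD[OF assms(3), of "insert j B"] by (auto simp: T_def)
    then show "(\<Sum>A\<in>Pow U. if j \<notin> B \<and> A = insert j B then T j else 0) = (if j \<notin> B then T j else 0)"
      using assms(1) by (cases "j \<in> B") (auto simp: sum.delta)
  qed
  also have "\<dots> = (\<Sum>j\<in>U - B. T j)"
    using assms(1) by (intro sum.mono_neutral_cong_right) auto
  finally show ?thesis by (simp only: T_def)
qed

lemma finite_face: "finite U \<Longrightarrow> D \<subseteq> Pow U \<Longrightarrow> A \<in> D \<Longrightarrow> finite A"
  by (meson PowD finite_subset subsetD)

lemma down_closed_faces_below:
  assumes "finite U" "D \<subseteq> Pow U" "down_closed D"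
  shows "down_closed (faces_below D m t)"
  unfolding down_closed_def
proof (intro ballI allI impI)
  fix A B assume A: "A \<in> faces_below D m t" and B: "B \<subseteq> A"
  then have "finite A" using finite_face[OF assms(1,2)] by (simp add: faces_below_def)
  then show "B \<in> faces_below D m t"
    using A B divides_lcm_label_mono[OF _ B] divides_trans down_closedD[OF assms(3) _ B]
    unfolding faces_below_def by blast
qed

text \<open>The weight \<open>m_A/m_B\<close> turns \<open>t/m_A\<close> into \<open>t/m_B\<close>.
  Within one multidegree the monomials are therefore forced, and only the boundary of the scalars
  remains.\<close>

lemma boundary_lift_chain:
  fixes b :: "nat set \<Rightarrow> 'k::field"
  assumes U: "finite U" "D \<subseteq> Pow U" and b: "b \<in> chains_on (faces_below D m t)"
  shows "boundary D m (lift_chain m t b) = lift_chain m t (chain_boundary U b)"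
proof
  fix B
  have bD: "lift_chain m t b \<in> chains_on D"
    using b by (auto simp: chains_on_def lift_chain_def faces_below_def)
  have "boundary D m (lift_chain m t b) B
      = (\<Sum>j\<in>U - B. Poly_Mapping.single (t - lcm_label m B) (face_sign j B * b (insert j B)))"
    unfolding boundary_eq[OF U bD]
  proof (rule sum.cong[OF refl])
    fix j
    let ?A = "insert j B"
    show "lift_chain m t b ?A * (face_sign j B * monomial (lcm_label m ?A - lcm_label m B))
        = Poly_Mapping.single (t - lcm_label m B) (face_sign j B * b ?A)"
    proof (cases "b ?A = 0")
      case False
      then have A: "?A \<in> D" "divides (lcm_label m ?A) t"
        using chains_onD[OF b] by (auto simp: faces_below_def)
      then have "finite ?A" using finite_face[OF U A(1)] by blast
      then have "divides (lcm_label m B) (lcm_label m ?A)"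
        by (intro divides_lcm_label_mono) auto
      then show ?thesis
        using divides_diff_split A(2)
        by (simp add: lift_chain_def face_sign_single monomial_def mult_single mult.commute)
    qed (simp add: lift_chain_def)
  qed
  then show "boundary D m (lift_chain m t b) B = lift_chain m t (chain_boundary U b) B"
    by (simp add: lift_chain_def chain_boundary_def single_sum)
qed

lemma boundary_graded:
  assumes U: "finite U" "D \<subseteq> Pow U" and f: "f \<in> chains_on D"
  shows "boundary D m f B
    = (\<Sum>t\<in>multidegrees D m f. lift_chain m t (chain_boundary U (graded_part m t f)) B)"
proof -
  have "finite D" using finite_subset[OF U(2)] U(1) by simp
  then have "f = (\<lambda>A. \<Sum>t\<in>multidegrees D m f. lift_chain m t (graded_part m t f) A)"
    using sum_graded_parts f by blast
  then have "boundary D m f B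
      = boundary D m (\<lambda>A. \<Sum>t\<in>multidegrees D m f. lift_chain m t (graded_part m t f) A) B"
    by simp
  then show ?thesis
    unfolding boundary_sum
    using boundary_lift_chain[OF U graded_part_in_chains_on[OF f]] by simp
qed

text \<open>Checked in each multidegree, where it is the vanishing of the square of the simplicial
  boundary.\<close>

lemma boundary_boundary:
  assumes U: "finite U" "D \<subseteq> Pow U" and D: "down_closed D" and f: "f \<in> chains_on D"
  shows "boundary D m (boundary D m f) B = 0"
proof -
  have cb: "chain_boundary U (graded_part m t f) \<in> chains_on (faces_below D m t)" for t
    using chain_boundary_in_chains down_closed_faces_below[OF U D] graded_part_in_chains_on[OF f]
    by blast
  have "boundary D m f = (\<lambda>B. \<Sum>t\<in>multidegrees D m f.
          lift_chain m t (chain_boundary U (graded_part m t f)) B)"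
    using boundary_graded[OF U f] by blast
  then have "boundary D m (boundary D m f) B = (\<Sum>t\<in>multidegrees D m f.
      lift_chain m t (chain_boundary U (chain_boundary U (graded_part m t f))) B)"
    by (simp add: boundary_sum boundary_lift_chain[OF U cb])
  then show ?thesis
    by (simp add: lift_chain_def chain_boundary_boundary[OF U(1)])
qed

text \<open>Boundaries of components of different multidegrees cannot cancel, so each component of a
  cycle is a cycle.\<close>

lemma graded_part_boundary_zero:
  assumes U: "finite U" "D \<subseteq> Pow U" and D: "down_closed D" and f: "f \<in> chains_on D"
    and cyc: "boundary D m f = (\<lambda>_. 0)" and t: "t \<in> multidegrees D m f"
  shows "chain_boundary U (graded_part m t f) = (\<lambda>_. 0)"
proof
  fix B
  have cb: "chain_boundary U (graded_part m s f) \<in> chains_on (faces_below D m s)" for s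
    using chain_boundary_in_chains down_closed_faces_below[OF U D] graded_part_in_chains_on[OF f]
    by blast
  have "finite D" using finite_subset[OF U(2)] U(1) by simp
  then have fin: "finite (multidegrees D m f)" by (rule finite_multidegrees)
  have "(\<lambda>B. \<Sum>s\<in>multidegrees D m f. lift_chain m s (chain_boundary U (graded_part m s f)) B) = (\<lambda>_. 0)"
    using boundary_graded[OF U f, of m] cyc by simp
  then have "0 = graded_part m t (\<lambda>B. \<Sum>s\<in>multidegrees D m f.
      lift_chain m s (chain_boundary U (graded_part m s f)) B) B"
    by (simp add: graded_part_def)
  also have "\<dots> = chain_boundary U (graded_part m t f) B"
    using fin t by (simp add: graded_part_sum graded_part_lift_chain[OF cb])
  finally show "chain_boundary U (graded_part m t f) B = 0" by simp
qed

section \<open>The modules of faces and exactness in positive homological degree\<close>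

lemma face_module_simps [simp]:
  "zero (face_module N D i) = (\<lambda>A. 0)"
  "add (face_module N D i) = (\<lambda>f g A. f A + g A)"
  "smult (face_module N D i) = (\<lambda>p f A. p * f A)"
  by (simp_all add: face_module_def)

lemma carrier_face_module:
  "f \<in> carrier (face_module N D i) \<longleftrightarrow>
     (\<forall>A. f A \<in> carrier (poly_ring N)) \<and> (\<forall>A. \<not> (A \<in> D \<and> card A = i) \<longrightarrow> f A = 0)"
  by (simp add: face_module_def)

lemma face_module_chains_on: "f \<in> carrier (face_module N D i) \<Longrightarrow> f \<in> chains_on D"
  by (auto simp: carrier_face_module chains_on_def)

lemma boundary_in_face_module:
  assumes U: "finite U" "D \<subseteq> Pow U" and D: "down_closed D"
    and m: "\<And>i. i \<in> U \<Longrightarrow> m i \<in> monomials N"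
    and f: "f \<in> carrier (face_module N D (Suc i))"
  shows "boundary D m f \<in> carrier (face_module N D i)"
proof -
  note eq = boundary_eq[OF U face_module_chains_on[OF f]]
  have "boundary D m f B \<in> carrier (poly_ring N)" for B
    unfolding eq
  proof (rule sum_in_poly_ring)
    fix j
    show "f (insert j B) * (face_sign j B * monomial (lcm_label m (insert j B) - lcm_label m B))
            \<in> carrier (poly_ring N)"
    proof (cases "insert j B \<in> D")
      case True
      then have "insert j B \<subseteq> U" using U by blast
      then have "lcm_label m (insert j B) \<in> monomials N"
        using lcm_label_in_monomials[OF finite_subset[OF _ U(1)]] m by blast
      then show ?thesis
        using f by (intro mult_in_poly_ring face_sign_in_poly_ring monomial_in_poly_ring diff_in_monomials)
          (simp_all add: carrier_face_module)
    next
      case False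
      then have "f (insert j B) = 0" using f unfolding carrier_face_module by blast
      then show ?thesis by (simp add: zero_in_poly_ring)
    qed
  qed
  moreover have "boundary D m f B = 0" if "\<not> (B \<in> D \<and> card B = i)" for B
    unfolding eq
  proof (rule sum.neutral, rule ballI)
    fix j assume j: "j \<in> U - B"
    have "\<not> (insert j B \<in> D \<and> card (insert j B) = Suc i)"
    proof
      assume A: "insert j B \<in> D \<and> card (insert j B) = Suc i"
      then have "finite (insert j B)" by (intro card_ge_0_finite) simp
      then have "card B = i" using A j by simp
      moreover have "B \<in> D" using A down_closedD[OF D] by blast
      ultimately show False using that by blast
    qed
    then have "f (insert j B) = 0" using f unfolding carrier_face_module by blast
    then show "f (insert j B) * (face_sign j B * monomial (lcm_label m (insert j B) - lcm_label m B)) = 0"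
      by simp
  qed
  ultimately show ?thesis unfolding carrier_face_module by blast
qed

text \<open>The boundary lowers the size of a face by one, so it commutes with truncation to one
  size. This restores the homological degree, which \<open>exact_chains\<close> ignores.\<close>

lemma chain_boundary_restrict_card:
  assumes B: "finite B"
  shows "chain_boundary U (\<lambda>A. if card A = Suc i then b A else 0) B
           = (if card B = i then chain_boundary U b B else 0)"
  using B by (auto simp: chain_boundary_def intro!: sum.cong sum.neutral)

text \<open>
  The criterion of Bayer, Peeva and Sturmfels: exactness over the polynomial ring is tested in each
  multidegree \<open>t\<close>, where it becomes exactness of the chain complex of the faces whose label divides
  \<open>t\<close>.
\<close>

lemma boundary_exact:
  fixes f :: "nat set \<Rightarrow> (nat \<Rightarrow>\<^sub>0 nat) \<Rightarrow>\<^sub>0 'k::field"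
  assumes U: "finite U" "D \<subseteq> Pow U" and D: "down_closed D"
    and m: "\<And>i. i \<in> U \<Longrightarrow> m i \<in> monomials N"
    and ex: "\<And>t. t \<in> monomials N \<Longrightarrow> faces_below D m t \<subseteq> {{}} \<or>
               exact_chains U (chains_on (faces_below D m t) :: (nat set \<Rightarrow> 'k) set)"
    and f: "f \<in> carrier (face_module N D (Suc i))"
    and cyc: "boundary D m f = (\<lambda>_. 0)"
  shows "\<exists>g\<in>carrier (face_module N D (Suc (Suc i))). boundary D m g = f"
proof -
  have fD: "f \<in> chains_on D" using face_module_chains_on f by blast
  have finD: "finite D" using finite_subset[OF U(2)] U(1) by simp
  define T where "T = multidegrees D m f"
  have TN: "t \<in> monomials N" if t: "t \<in> T" for t
  proof -
    obtain A u where Au: "A \<in> D" "u \<in> Poly_Mapping.keys (f A)" "t = lcm_label m A + u"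
      using t unfolding T_def multidegrees_def by blast
    have "A \<subseteq> U" using Au U by blast
    then have "lcm_label m A \<in> monomials N"
      using lcm_label_in_monomials[OF finite_subset[OF _ U(1)]] m by blast
    moreover have "u \<in> monomials N"
      using f Au unfolding carrier_face_module carrier_poly_ring by blast
    ultimately show ?thesis using Au add_in_monomials by blast
  qed
  have "\<exists>b\<in>chains_on (faces_below D m t). chain_boundary U b = graded_part m t f" if "t \<in> T" for t
    using ex[OF TN[OF that]]
  proof
    \<comment> \<open>Only the empty face lies below \<open>t\<close>. That complex is not acyclic,
      but \<open>f\<close> lives on faces with \<open>Suc i\<close> vertices and has no coefficient
      at \<open>{}\<close>.\<close>
    assume none: "faces_below D m t \<subseteq> {{}}"
    have "graded_part m t f A = 0" for A
    proof (cases "A = {}")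
      case True
      then have "f A = 0" using f unfolding carrier_face_module by simp
      then show ?thesis by (simp add: graded_part_def)
    next
      case False
      then show ?thesis
        using none by (intro chains_onD[OF graded_part_in_chains_on[OF fD]]) blast
    qed
    then have "graded_part m t f = (\<lambda>_. 0)" by blast
    then show ?thesis
      by (intro bexI[of _ "\<lambda>_. 0"]) (auto simp: chain_boundary_def chains_on_def)
  next
    assume "exact_chains U (chains_on (faces_below D m t) :: (nat set \<Rightarrow> 'k) set)"
    then show ?thesis
      using graded_part_in_chains_on[OF fD] graded_part_boundary_zero[OF U D fD cyc] that
      unfolding exact_chains_def T_def by (metis imageE)
  qed
  then obtain b where b: "\<And>t. t \<in> T \<Longrightarrow> b t \<in> chains_on (faces_below D m t)"
    "\<And>t. t \<in> T \<Longrightarrow> chain_boundary U (b t) = graded_part m t f" by metis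
  \<comment> \<open>The filling \<open>b t\<close> may contain faces of any size; only those with
    one vertex more than the faces of \<open>f\<close> are kept.\<close>
  define b' where "b' = (\<lambda>t A. if card A = Suc (Suc i) then b t A else 0)"
  have b'_chain: "b' t \<in> chains_on (faces_below D m t)" if "t \<in> T" for t
    using b(1)[OF that] by (auto simp: b'_def chains_on_def)
  have b'_boundary: "chain_boundary U (b' t) = graded_part m t f" if t: "t \<in> T" for t
  proof
    fix B
    have sub: "faces_below D m t \<subseteq> Pow U" using U by (auto simp: faces_below_def)
    show "chain_boundary U (b' t) B = graded_part m t f B"
    proof (cases "B \<subseteq> U")
      case True
      then have "finite B" using finite_subset[of B U] U(1) by simp
      then have "chain_boundary U (b' t) B = (if card B = Suc i then graded_part m t f B else 0)"
        unfolding b'_def b(2)[OF t, symmetric] by (rule chain_boundary_restrict_card)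
      moreover have "graded_part m t f B = 0" if "card B \<noteq> Suc i"
        using that f by (simp add: graded_part_def carrier_face_module)
      ultimately show ?thesis by presburger
    next
      case False
      have "chain_boundary U (b' t) \<in> chains_on (faces_below D m t)"
        using chain_boundary_in_chains down_closed_faces_below[OF U D] b'_chain[OF t] by blast
      then show ?thesis
        using False sub chains_onD graded_part_in_chains_on[OF fD] by (metis PowD subsetD)
    qed
  qed
  define g where "g = (\<lambda>A. \<Sum>t\<in>T. lift_chain m t (b' t) A)"
  have "boundary D m g B = f B" for B
  proof -
    have "boundary D m g B = (\<Sum>t\<in>T. lift_chain m t (graded_part m t f) B)"
      unfolding g_def boundary_sum
      using boundary_lift_chain[OF U b'_chain] b'_boundary by simp
    then show ?thesis using sum_graded_parts[OF finD fD] unfolding T_def by metis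
  qed
  moreover have "g \<in> carrier (face_module N D (Suc (Suc i)))"
    unfolding carrier_face_module g_def
  proof (intro conjI allI impI sum_in_poly_ring sum.neutral ballI)
    fix A t assume "t \<in> T"
    show "lift_chain m t (b' t) A \<in> carrier (poly_ring N)"
      unfolding lift_chain_def by (intro single_in_poly_ring diff_in_monomials TN \<open>t \<in> T\<close>)
  next
    fix A t assume A: "\<not> (A \<in> D \<and> card A = Suc (Suc i))" and t: "t \<in> T"
    have "b' t A = 0"
    proof (cases "A \<in> D")
      case True
      then show ?thesis using A by (simp add: b'_def)
    next
      case False
      then show ?thesis by (intro chains_onD[OF b'_chain[OF t]]) (simp add: faces_below_def)
    qed
    then show "lift_chain m t (b' t) A = 0" by (simp add: lift_chain_def)
  qed
  ultimately show ?thesis by blast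
qed

section \<open>Modules over the polynomial ring\<close>

lemma abelian_group_poly_ring: "abelian_group (poly_ring N :: ((nat \<Rightarrow>\<^sub>0 nat) \<Rightarrow>\<^sub>0 'k::field) ring)"
proof (rule abelian_groupI)
  fix p :: "(nat \<Rightarrow>\<^sub>0 nat) \<Rightarrow>\<^sub>0 'k" assume "p \<in> carrier (poly_ring N)"
  then show "\<exists>q\<in>carrier (poly_ring N). q \<oplus>\<^bsub>poly_ring N\<^esub> p = \<zero>\<^bsub>poly_ring N\<^esub>"
    using uminus_in_poly_ring by (intro bexI[of _ "- p"]) auto
qed (simp_all add: add_in_poly_ring zero_in_poly_ring ac_simps)

lemma cring_poly_ring: "cring (poly_ring N)"
  by (intro cringI abelian_group_poly_ring comm_monoidI)
    (simp_all add: mult_in_poly_ring one_in_poly_ring algebra_simps)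

lemma ring_poly_ring: "ring (poly_ring N)"
  using cring_poly_ring cring.axioms(1) by blast

lemma a_inv_poly_ring:
  assumes "p \<in> carrier (poly_ring N)"
  shows "\<ominus>\<^bsub>poly_ring N\<^esub> p = - p"
  by (rule abelian_group.minus_equality[OF abelian_group_poly_ring])
    (use assms uminus_in_poly_ring in auto)

lemma ideal_poly_ringI:
  assumes "J \<subseteq> carrier (poly_ring N)" "0 \<in> J"
    and "\<And>p q. p \<in> J \<Longrightarrow> q \<in> J \<Longrightarrow> p + q \<in> J"
    and mult: "\<And>p q. p \<in> carrier (poly_ring N) \<Longrightarrow> q \<in> J \<Longrightarrow> p * q \<in> J"
  shows "ideal J (poly_ring N)"
proof (rule idealI[OF ring_poly_ring])
  show "subgroup J (add_monoid (poly_ring N))"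
  proof (rule subgroup.intro)
    fix p assume p: "p \<in> J"
    have "(- 1) * p \<in> J"
      by (intro mult p uminus_in_poly_ring one_in_poly_ring)
    then show "inv\<^bsub>add_monoid (poly_ring N)\<^esub> p \<in> J"
      using p assms(1) a_inv_poly_ring[of p N] by (auto simp: a_inv_def)
  qed (use assms in auto)
  show "p \<otimes>\<^bsub>poly_ring N\<^esub> q \<in> J" if "p \<in> J" "q \<in> carrier (poly_ring N)" for p q
    using mult[OF that(2,1)] by (simp add: mult.commute)
qed (use mult in auto)

lemma monomials_subset_poly_ring:
  "T \<subseteq> monomials N \<Longrightarrow> monomial ` T \<subseteq> carrier (poly_ring N)"
  using monomial_in_poly_ring by blast

section \<open>Ideals generated by monomials\<close>

lemma genideal_sum_closed:
  assumes S: "S \<subseteq> carrier (poly_ring N)"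
    and f: "\<And>i. i \<in> A \<Longrightarrow> f i \<in> genideal (poly_ring N) S"
  shows "sum f A \<in> genideal (poly_ring N) S"
proof -
  interpret ideal "genideal (poly_ring N) S" "poly_ring N"
    using ring.genideal_ideal[OF ring_poly_ring S] .
  show ?thesis
    using f
  proof (induction A rule: infinite_finite_induct)
    case (insert i A)
    then have "f i \<oplus>\<^bsub>poly_ring N\<^esub> sum f A \<in> genideal (poly_ring N) S"
      by (intro additive_subgroup.a_closed[OF additive_subgroup_axioms]) auto
    then show ?case using insert by simp
  qed (use additive_subgroup.zero_closed[OF additive_subgroup_axioms] in auto)
qed

lemma genideal_mult_closed:
  assumes S: "S \<subseteq> carrier (poly_ring N)" and "p \<in> carrier (poly_ring N)" "q \<in> S"
  shows "p * q \<in> genideal (poly_ring N) S"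
proof -
  interpret ideal "genideal (poly_ring N) S" "poly_ring N"
    using ring.genideal_ideal[OF ring_poly_ring S] .
  have "q \<in> genideal (poly_ring N) S" using ring.genideal_self[OF ring_poly_ring S] assms by blast
  then have "p \<otimes>\<^bsub>poly_ring N\<^esub> q \<in> genideal (poly_ring N) S" using assms I_l_closed by blast
  then show ?thesis by simp
qed

text \<open>The polynomials all of whose terms are divisible by a member of \<open>T\<close> form an
  ideal that contains the generators.\<close>

lemma genideal_monomials_keys:
  fixes p :: "(nat \<Rightarrow>\<^sub>0 nat) \<Rightarrow>\<^sub>0 'k::field"
  assumes T: "T \<subseteq> monomials N" and p: "p \<in> genideal (poly_ring N) (monomial ` T)"
    and u: "u \<in> Poly_Mapping.keys p"
  shows "\<exists>t\<in>T. divides t u"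
proof -
  define J where "J = {q :: (nat \<Rightarrow>\<^sub>0 nat) \<Rightarrow>\<^sub>0 'k. q \<in> carrier (poly_ring N) \<and>
    (\<forall>u\<in>Poly_Mapping.keys q. \<exists>t\<in>T. divides t u)}"
  have "ideal J (poly_ring N)"
  proof (rule ideal_poly_ringI)
    fix q r :: "(nat \<Rightarrow>\<^sub>0 nat) \<Rightarrow>\<^sub>0 'k" assume "q \<in> J" "r \<in> J"
    then show "q + r \<in> J"
      unfolding J_def using add_in_poly_ring Poly_Mapping.keys_add[of q r] by blast
  next
    fix q r :: "(nat \<Rightarrow>\<^sub>0 nat) \<Rightarrow>\<^sub>0 'k" assume q: "q \<in> carrier (poly_ring N)" and r: "r \<in> J"
    have "\<exists>t\<in>T. divides t u" if u: "u \<in> Poly_Mapping.keys (q * r)" for u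
    proof -
      obtain a b where ab: "u = a + b" "b \<in> Poly_Mapping.keys r"
        using keys_mult[of q r] u by blast
      then obtain t where "t \<in> T" "divides t b" using r unfolding J_def by blast
      moreover have "divides b u"
        using divides_add_left[of b a] ab by (simp add: add.commute)
      ultimately show ?thesis using divides_trans by blast
    qed
    then show "q * r \<in> J" using q r mult_in_poly_ring unfolding J_def by blast
  qed (auto simp: J_def zero_in_poly_ring)
  moreover have "monomial ` T \<subseteq> J"
    using T by (auto simp: J_def monomial_def intro!: single_in_poly_ring intro: divides_refl)
  ultimately have "p \<in> J" using ring.genideal_minimal[OF ring_poly_ring] p by blast
  then show ?thesis using u by (simp add: J_def)
qed

text \<open>The combinations already form an ideal containing the generators. The coefficients,
  indexed by the vertices, serve later as a preimage under the first differential.\<close>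

lemma genideal_monomials_finite:
  fixes p :: "(nat \<Rightarrow>\<^sub>0 nat) \<Rightarrow>\<^sub>0 'k::field"
  assumes "finite U" "\<And>j. j \<in> U \<Longrightarrow> m j \<in> monomials N"
    and p: "p \<in> genideal (poly_ring N) (monomial ` m ` U)"
  shows "\<exists>c. (\<forall>j. c j \<in> carrier (poly_ring N)) \<and> p = (\<Sum>j\<in>U. c j * monomial (m j))"
proof -
  define J where "J = {q :: (nat \<Rightarrow>\<^sub>0 nat) \<Rightarrow>\<^sub>0 'k. \<exists>c. (\<forall>j. c j \<in> carrier (poly_ring N)) \<and> q = (\<Sum>j\<in>U. c j * monomial (m j))}"
  have "ideal J (poly_ring N)"
  proof (rule ideal_poly_ringI)
    show "J \<subseteq> carrier (poly_ring N)"
      unfolding J_def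
      by (auto intro!: sum_in_poly_ring mult_in_poly_ring monomial_in_poly_ring assms(2))
    show "0 \<in> J"
      unfolding J_def by (rule CollectI, rule exI[of _ "\<lambda>_. 0"]) (simp add: zero_in_poly_ring)
  next
    fix q r :: "(nat \<Rightarrow>\<^sub>0 nat) \<Rightarrow>\<^sub>0 'k" assume "q \<in> J" "r \<in> J"
    then obtain c d where "\<forall>j. c j \<in> carrier (poly_ring N)" "q = (\<Sum>j\<in>U. c j * monomial (m j))"
      "\<forall>j. d j \<in> carrier (poly_ring N)" "r = (\<Sum>j\<in>U. d j * monomial (m j))"
      unfolding J_def by blast
    then show "q + r \<in> J"
      unfolding J_def
      by (intro CollectI exI[of _ "\<lambda>j. c j + d j"]) (simp add: add_in_poly_ring distrib_right sum.distrib)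
  next
    fix q r :: "(nat \<Rightarrow>\<^sub>0 nat) \<Rightarrow>\<^sub>0 'k" assume "q \<in> carrier (poly_ring N)" "r \<in> J"
    then obtain c where "\<forall>j. c j \<in> carrier (poly_ring N)" "r = (\<Sum>j\<in>U. c j * monomial (m j))"
      unfolding J_def by blast
    then show "q * r \<in> J"
      unfolding J_def using \<open>q \<in> carrier (poly_ring N)\<close>
      by (intro CollectI exI[of _ "\<lambda>j. q * c j"]) (simp add: mult_in_poly_ring sum_distrib_left mult.assoc)
  qed
  moreover have "monomial ` m ` U \<subseteq> J"
  proof clarify
    fix i assume i: "i \<in> U"
    have "monomial (m i) = (\<Sum>j\<in>U. (if j = i then 1 else 0) * monomial (m j))"
      using i assms(1) by (simp add: if_distrib[of "\<lambda>x. x * _"] cong: if_cong)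
    then show "monomial (m i) \<in> J"
      unfolding J_def
      by (intro CollectI exI[of _ "\<lambda>j. if j = i then 1 else 0"]) (simp add: zero_in_poly_ring one_in_poly_ring)
  qed
  ultimately have "p \<in> J" using ring.genideal_minimal[OF ring_poly_ring] p by blast
  then show ?thesis by (simp add: J_def)
qed

text \<open>A generator that could be dropped would be divisible by one of those kept.\<close>

lemma minimal_monomial_generators_antichain:
  assumes T: "T \<subseteq> monomials N" and anti: "\<And>s t. s \<in> T \<Longrightarrow> t \<in> T \<Longrightarrow> divides s t \<Longrightarrow> s = t"
  shows "minimal_monomial_generators N
           (genideal (poly_ring N) (monomial ` T) :: ((nat \<Rightarrow>\<^sub>0 nat) \<Rightarrow>\<^sub>0 'k::field) set) T"
  unfolding minimal_monomial_generators_def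
proof (intro conjI allI impI refl T notI)
  fix U assume U: "U \<subset> T"
    and eq: "genideal (poly_ring N) (monomial ` U)
               = (genideal (poly_ring N) (monomial ` T) :: ((nat \<Rightarrow>\<^sub>0 nat) \<Rightarrow>\<^sub>0 'k) set)"
  obtain t where t: "t \<in> T" "t \<notin> U" using U by blast
  have "(monomial t :: (nat \<Rightarrow>\<^sub>0 nat) \<Rightarrow>\<^sub>0 'k) \<in> genideal (poly_ring N) (monomial ` U)"
    using eq t ring.genideal_self[OF ring_poly_ring monomials_subset_poly_ring[OF T]] by blast
  moreover have "t \<in> Poly_Mapping.keys (monomial t :: (nat \<Rightarrow>\<^sub>0 nat) \<Rightarrow>\<^sub>0 'k)"
    by (simp add: monomial_def)
  ultimately obtain s where "s \<in> U" "divides s t"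
    using genideal_monomials_keys[of U N] U T by blast
  then show False using anti[of s t] U t by blast
qed

lemma monomial_in_irrelevant_ideal:
  assumes t: "t \<in> monomials N" "t \<noteq> 0"
  shows "(monomial t :: (nat \<Rightarrow>\<^sub>0 nat) \<Rightarrow>\<^sub>0 'k::field) \<in> irrelevant_ideal N"
proof -
  define e where "e = (\<lambda>i::nat. Poly_Mapping.single i (1::nat))"
  obtain x where x: "Poly_Mapping.lookup t x \<noteq> 0"
    using t(2) by (metis lookup_zero poly_mapping_eqI)
  then have "x < N" using t(1) unfolding monomials_def in_keys_iff[symmetric] by blast
  have "divides (e x) t" using x by (simp add: divides_def e_def lookup_single when_def)
  then have "monomial t = (monomial (t - e x) * monomial (e x) :: (nat \<Rightarrow>\<^sub>0 nat) \<Rightarrow>\<^sub>0 'k)"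
    using divides_add_diff by (simp add: monomial_def mult_single add.commute)
  moreover have "(\<lambda>i. monomial (e i)) ` {..<N} \<subseteq> carrier (poly_ring N)"
    by (auto simp: e_def monomials_def intro!: monomial_in_poly_ring)
  then have "monomial (t - e x) * monomial (e x)
      \<in> genideal (poly_ring N) ((\<lambda>i. monomial (e i) :: (nat \<Rightarrow>\<^sub>0 nat) \<Rightarrow>\<^sub>0 'k) ` {..<N})"
    by (intro genideal_mult_closed monomial_in_poly_ring diff_in_monomials t) (use \<open>x < N\<close> in auto)
  ultimately show ?thesis by (simp add: irrelevant_ideal_def e_def)
qed

section \<open>Freeness of the face modules, and the quotient as a module\<close>

lemma abelian_group_face_module: "abelian_group (face_module N D i)"
proof (rule abelian_groupI)
  fix f assume "f \<in> carrier (face_module N D i)"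
  then show "\<exists>g\<in>carrier (face_module N D i). g \<oplus>\<^bsub>face_module N D i\<^esub> f = \<zero>\<^bsub>face_module N D i\<^esub>"
    by (intro bexI[of _ "\<lambda>A. - f A"]) (auto simp: carrier_face_module uminus_in_poly_ring)
qed (auto simp: carrier_face_module add_in_poly_ring zero_in_poly_ring ac_simps)

lemma module_face_module: "module (poly_ring N) (face_module N D i)"
  by (intro moduleI cring_poly_ring abelian_group_face_module)
    (auto simp: carrier_face_module mult_in_poly_ring algebra_simps)

lemma finsum_face_module:
  assumes "finite S" "\<And>e. e \<in> S \<Longrightarrow> g e \<in> carrier (face_module N D i)"
  shows "finsum (face_module N D i) g S = (\<lambda>B. \<Sum>e\<in>S. g e B)"
  using assms
proof (induction S rule: finite_induct)
  interpret abelian_group "face_module N D i" by (rule abelian_group_face_module)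
  {
    case empty
    show ?case by simp
  next
    case (insert e S)
    then show ?case by (subst finsum_insert) auto
  }
qed

lemma face_basis_in_face_module:
  "A \<in> D \<Longrightarrow> card A = i \<Longrightarrow> face_basis A \<in> carrier (face_module N D i)"
  by (auto simp: carrier_face_module face_basis_def zero_in_poly_ring one_in_poly_ring)

lemma inj_face_basis: "inj (face_basis :: nat set \<Rightarrow> nat set \<Rightarrow> (nat \<Rightarrow>\<^sub>0 nat) \<Rightarrow>\<^sub>0 'k::field)"
proof (rule injI)
  fix A B assume "(face_basis A :: nat set \<Rightarrow> (nat \<Rightarrow>\<^sub>0 nat) \<Rightarrow>\<^sub>0 'k) = face_basis B"
  then have "(face_basis A A :: (nat \<Rightarrow>\<^sub>0 nat) \<Rightarrow>\<^sub>0 'k) = face_basis B A" by simp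
  then show "A = B" by (simp add: face_basis_def split: if_splits)
qed

text \<open>Coordinates in \<open>module_basis\<close> are indexed by basis elements, not by faces.
  Injectivity of \<open>face_basis\<close> translates between the two, after which every admissible
  combination can be evaluated face by face.\<close>

lemma module_basis_face_module:
  assumes D: "finite D"
  shows "module_basis (poly_ring N :: ((nat \<Rightarrow>\<^sub>0 nat) \<Rightarrow>\<^sub>0 'k::field) ring) (face_module N D i)
           (face_basis ` {A \<in> D. card A = i})"
proof -
  define L where "L = {A \<in> D. card A = i}"
  let ?E = "face_basis ` L :: (nat set \<Rightarrow> (nat \<Rightarrow>\<^sub>0 nat) \<Rightarrow>\<^sub>0 'k) set"
  let ?M = "face_module N D i :: ((nat \<Rightarrow>\<^sub>0 nat) \<Rightarrow>\<^sub>0 'k, nat set \<Rightarrow> (nat \<Rightarrow>\<^sub>0 nat) \<Rightarrow>\<^sub>0 'k) module"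
  have fL: "finite L" using D by (simp add: L_def)
  have E: "?E \<subseteq> carrier ?M" using face_basis_in_face_module by (auto simp: L_def)
  have comb: "finite {e. c e \<noteq> 0} \<and>
      (\<Oplus>\<^bsub>?M\<^esub>e\<in>{e. c e \<noteq> 0}. c e \<odot>\<^bsub>?M\<^esub> e) = (\<lambda>B. if B \<in> L then c (face_basis B) else 0)"
    if c: "c \<in> ?E \<rightarrow> carrier (poly_ring N)" "\<forall>e. e \<notin> ?E \<longrightarrow> c e = 0" for c
  proof
    have sub: "{e. c e \<noteq> 0} \<subseteq> ?E" using c by blast
    then show fin: "finite {e. c e \<noteq> 0}" using fL finite_subset by blast
    have "c e \<odot>\<^bsub>?M\<^esub> e \<in> carrier ?M" if "c e \<noteq> 0" for e
    proof -
      have "e \<in> ?E" using that sub by blast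
      then show ?thesis using c(1) E module.smult_closed[OF module_face_module] by blast
    qed
    then have "(\<Oplus>\<^bsub>?M\<^esub>e\<in>{e. c e \<noteq> 0}. c e \<odot>\<^bsub>?M\<^esub> e)
        = (\<lambda>B. \<Sum>e\<in>{e. c e \<noteq> 0}. (c e \<odot>\<^bsub>?M\<^esub> e) B)"
      by (intro finsum_face_module fin) auto
    also have "\<dots> = (\<lambda>B. \<Sum>e\<in>?E. c e * e B)"
    proof
      fix B
      show "(\<Sum>e\<in>{e. c e \<noteq> 0}. (c e \<odot>\<^bsub>?M\<^esub> e) B) = (\<Sum>e\<in>?E. c e * e B)"
        using fL sub by (intro sum.mono_neutral_cong_left) auto
    qed
    also have "\<dots> = (\<lambda>B. if B \<in> L then c (face_basis B) else 0)"
    proof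
      fix B
      have "(\<Sum>e\<in>?E. c e * e B) = (\<Sum>A\<in>L. c (face_basis A) * face_basis A B)"
        by (subst sum.reindex) (auto intro: inj_on_subset[OF inj_face_basis])
      also have "\<dots> = (\<Sum>A\<in>L. if A = B then c (face_basis B) else 0)"
        by (intro sum.cong refl) (simp add: face_basis_def)
      also have "\<dots> = (if B \<in> L then c (face_basis B) else 0)" using fL by simp
      finally show "(\<Sum>e\<in>?E. c e * e B) = (if B \<in> L then c (face_basis B) else 0)" .
    qed
    finally show "(\<Oplus>\<^bsub>?M\<^esub>e\<in>{e. c e \<noteq> 0}. c e \<odot>\<^bsub>?M\<^esub> e) = (\<lambda>B. if B \<in> L then c (face_basis B) else 0)" .
  qed
  show ?thesis
    unfolding module_basis_def L_def[symmetric]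
  proof (intro conjI E ballI)
    fix x assume x: "x \<in> carrier ?M"
    \<comment> \<open>The coordinate at the basis element of \<open>A\<close> is the value
      \<open>x A\<close>; the inverse of \<open>face_basis\<close> recovers
      \<open>A\<close>.\<close>
    define c :: "(nat set \<Rightarrow> (nat \<Rightarrow>\<^sub>0 nat) \<Rightarrow>\<^sub>0 'k) \<Rightarrow> (nat \<Rightarrow>\<^sub>0 nat) \<Rightarrow>\<^sub>0 'k"
      where "c = (\<lambda>e. if e \<in> ?E then x (inv_into UNIV face_basis e) else 0)"
    have cb: "c (face_basis B) = x B" if "B \<in> L" for B
      using that by (simp add: c_def inv_into_f_f[OF inj_face_basis])
    have xL: "x B = 0" if "B \<notin> L" for B
      using that x by (simp add: carrier_face_module L_def)
    have xc: "x = (\<lambda>B. if B \<in> L then c (face_basis B) else 0)"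
      using cb xL by auto
    have c: "c \<in> ?E \<rightarrow> carrier (poly_ring N)" "\<forall>e. e \<notin> ?E \<longrightarrow> c e = 0"
      using x by (auto simp: c_def carrier_face_module)
    show "\<exists>!c. c \<in> ?E \<rightarrow> carrier (poly_ring N) \<and> (\<forall>e. e \<notin> ?E \<longrightarrow> c e = \<zero>\<^bsub>poly_ring N\<^esub>) \<and>
        finite {e. c e \<noteq> \<zero>\<^bsub>poly_ring N\<^esub>} \<and>
        x = (\<Oplus>\<^bsub>?M\<^esub>e\<in>{e. c e \<noteq> \<zero>\<^bsub>poly_ring N\<^esub>}. c e \<odot>\<^bsub>?M\<^esub> e)"
      unfolding poly_ring_simps
    proof (rule ex1I[of _ c])
      show "c \<in> ?E \<rightarrow> carrier (poly_ring N) \<and> (\<forall>e. e \<notin> ?E \<longrightarrow> c e = 0) \<and>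
        finite {e. c e \<noteq> 0} \<and> x = (\<Oplus>\<^bsub>?M\<^esub>e\<in>{e. c e \<noteq> 0}. c e \<odot>\<^bsub>?M\<^esub> e)"
        using c conjunct1[OF comb[OF c]] trans[OF xc conjunct2[OF comb[OF c], symmetric]]
        by (intro conjI)
    next
      fix d assume d: "d \<in> ?E \<rightarrow> carrier (poly_ring N) \<and> (\<forall>e. e \<notin> ?E \<longrightarrow> d e = 0) \<and>
        finite {e. d e \<noteq> 0} \<and> x = (\<Oplus>\<^bsub>?M\<^esub>e\<in>{e. d e \<noteq> 0}. d e \<odot>\<^bsub>?M\<^esub> e)"
      then have "(\<Oplus>\<^bsub>?M\<^esub>e\<in>{e. d e \<noteq> 0}. d e \<odot>\<^bsub>?M\<^esub> e)
          = (\<lambda>B. if B \<in> L then d (face_basis B) else 0)"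
        by (intro conjunct2[OF comb]) blast+
      with d have "x = (\<lambda>B. if B \<in> L then d (face_basis B) else 0)"
        by (elim conjE) (rule trans)
      then have dc: "d (face_basis B) = c (face_basis B)" if "B \<in> L" for B
        using cb[OF that] that by simp
      show "d = c"
      proof
        fix e
        show "d e = c e"
        proof (cases "e \<in> ?E")
          case True
          then show ?thesis using dc by blast
        next
          case False
          then show ?thesis using d c(2) by simp
        qed
      qed
    qed
  qed
qed

lemma free_module_face_module: "finite D \<Longrightarrow> free_module (poly_ring N) (face_module N D i)"
  unfolding free_module_def using module_face_module module_basis_face_module by blast

lemma quotient_module_simps [simp]:
  "carrier (quotient_module R I) = carrier (R Quot I)"
  "add (quotient_module R I) = add (R Quot I)"
  "zero (quotient_module R I) = I"
  "smult (quotient_module R I) = (\<lambda>a X. (I +>\<^bsub>R\<^esub> a) \<otimes>\<^bsub>R Quot I\<^esub> X)"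
  by (simp_all add: quotient_module_def ring.defs FactRing_def)

lemma module_quotient_module:
  assumes R: "cring R" and I: "ideal I R"
  shows "module R (quotient_module R I)"
proof -
  interpret Q: cring "R Quot I" using ideal.quotient_is_cring[OF I R] .
  have h: "(+>\<^bsub>R\<^esub>) I \<in> ring_hom R (R Quot I)" by (rule ideal.rcos_ring_hom[OF I])
  have zero: "\<zero>\<^bsub>R Quot I\<^esub> = I" by (simp add: FactRing_def)
  have "abelian_group (quotient_module R I)"
  proof (rule abelian_groupI)
    fix X assume "X \<in> carrier (quotient_module R I)"
    then show "\<exists>Y\<in>carrier (quotient_module R I).
        Y \<oplus>\<^bsub>quotient_module R I\<^esub> X = \<zero>\<^bsub>quotient_module R I\<^esub>"
      using Q.l_neg zero by (intro bexI[of _ "\<ominus>\<^bsub>R Quot I\<^esub> X"]) auto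
    show "Z \<oplus>\<^bsub>quotient_module R I\<^esub> X = X \<oplus>\<^bsub>quotient_module R I\<^esub> Z"
      if "Z \<in> carrier (quotient_module R I)" for Z
      using that \<open>X \<in> _\<close> by (simp add: Q.a_comm)
  qed (use Q.zero_closed Q.l_zero zero in \<open>auto simp: Q.a_assoc\<close>)
  then show ?thesis
  proof (intro moduleI R)
    fix X assume "X \<in> carrier (quotient_module R I)"
    then show "\<one>\<^bsub>R\<^esub> \<odot>\<^bsub>quotient_module R I\<^esub> X = X"
      using ring_hom_one[OF h] by simp
  qed (simp_all add: ring_hom_closed[OF h] ring_hom_add[OF h] ring_hom_mult[OF h]
      Q.l_distr Q.r_distr Q.m_assoc)
qed

lemma submodule_sum_closed:
  assumes H: "submodule H (poly_ring N) (face_module N D i)"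
    and g: "\<And>a. a \<in> S \<Longrightarrow> g a \<in> H"
  shows "(\<lambda>B. \<Sum>a\<in>S. g a B) \<in> H"
proof -
  have sg: "subgroup H (add_monoid (face_module N D i))" using H submodule.axioms by blast
  show ?thesis
    using g
  proof (induction S rule: infinite_finite_induct)
    case (insert a S)
    then have "(\<lambda>B. g a B + (\<Sum>a\<in>S. g a B)) \<in> H"
      using subgroup.m_closed[OF sg, of "g a" "\<lambda>B. \<Sum>a\<in>S. g a B"] by simp
    then show ?case using insert by simp
  qed (use subgroup.one_closed[OF sg] in auto)
qed

section \<open>Minimality and the assembly of the resolution\<close>

lemma boundary_linear_map:
  assumes "finite U" "D \<subseteq> Pow U" "down_closed D" "\<And>i. i \<in> U \<Longrightarrow> m i \<in> monomials N"
  shows "boundary D m \<in> linear_maps (poly_ring N) (face_module N D (Suc i)) (face_module N D i)"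
  unfolding linear_maps_def
  using boundary_in_face_module[OF assms]
  by (auto simp: boundary_def distrib_right sum.distrib sum_distrib_left mult.assoc)

text \<open>Every matrix entry of the differential is a sign times \<open>m_A/m_B\<close> with
  \<open>B = A - {j}\<close>. As the labels differ, this monomial is not 1 and lies in the
  irrelevant ideal.\<close>

lemma boundary_minimal:
  fixes f :: "nat set \<Rightarrow> (nat \<Rightarrow>\<^sub>0 nat) \<Rightarrow>\<^sub>0 'k::field"
  assumes U: "finite U" "D \<subseteq> Pow U" and D: "down_closed D"
    and m: "\<And>i. i \<in> U \<Longrightarrow> m i \<in> monomials N"
    and labels: "\<And>A j. A \<in> D \<Longrightarrow> j \<in> A \<Longrightarrow> lcm_label m A \<noteq> lcm_label m (A - {j})"
    and f: "f \<in> carrier (face_module N D (Suc i))"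
  shows "boundary D m f \<in> ideal_smult_module (poly_ring N) (irrelevant_ideal N) (face_module N D i)"
  unfolding ideal_smult_module_def
proof clarify
  fix H assume H: "submodule H (poly_ring N) (face_module N D i)"
    and gen: "\<forall>a\<in>irrelevant_ideal N. \<forall>x\<in>carrier (face_module N D i :: (_, nat set \<Rightarrow> (nat \<Rightarrow>\<^sub>0 nat) \<Rightarrow>\<^sub>0 'k) module).
                a \<odot>\<^bsub>face_module N D i\<^esub> x \<in> H"
  have summand: "(\<lambda>B. f A * (face_sign j A * monomial (lcm_label m A - lcm_label m (A - {j})) *
                       face_basis (A - {j}) B)) \<in> H" if A: "A \<in> D" "j \<in> A" for A j
  proof (cases "card A = Suc i")
    case True
    define t where "t = lcm_label m A - lcm_label m (A - {j})"
    have AU: "A \<subseteq> U" using A U by blast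
    then have fA: "finite A" using U(1) finite_subset[of A U] by simp
    have "lcm_label m A \<in> monomials N"
      using lcm_label_in_monomials[OF fA] m AU by blast
    then have "t \<in> monomials N" unfolding t_def by (rule diff_in_monomials)
    moreover have "t \<noteq> 0"
      using divides_add_diff[OF divides_lcm_label_mono[OF fA, of "A - {j}" m]] labels[OF A]
      unfolding t_def by auto
    ultimately have "monomial t \<in> (irrelevant_ideal N :: ((nat \<Rightarrow>\<^sub>0 nat) \<Rightarrow>\<^sub>0 'k) set)"
      by (rule monomial_in_irrelevant_ideal)
    moreover have "(\<lambda>B. f A * face_sign j A * face_basis (A - {j}) B) \<in> carrier (face_module N D i)"
    proof -
      have "A - {j} \<in> D" using down_closedD[OF D A(1)] by blast
      moreover have "card (A - {j}) = i" using True A fA by simp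
      ultimately have "face_basis (A - {j}) \<in> carrier (face_module N D i)"
        by (rule face_basis_in_face_module)
      moreover have "f A * face_sign j A \<in> carrier (poly_ring N)"
        using f by (intro mult_in_poly_ring face_sign_in_poly_ring) (simp add: carrier_face_module)
      ultimately show ?thesis
        using module.smult_closed[OF module_face_module, of "f A * face_sign j A" N "face_basis (A - {j})" D i]
        by simp
    qed
    ultimately have "(\<lambda>B. monomial t * (f A * face_sign j A * face_basis (A - {j}) B)) \<in> H"
      using gen by auto
    then show ?thesis unfolding t_def by (simp add: ac_simps)
  next
    case False
    then have "f A = 0" using f by (simp add: carrier_face_module)
    \<comment> \<open>The summand is zero, and zero belongs to \<open>H\<close> as an empty
      sum.\<close>
    then show ?thesis
      using submodule_sum_closed[OF H, of "{}"] by simp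
  qed
  show "boundary D m f \<in> H"
    unfolding boundary_def boundary_of_face_def sum_distrib_left
    by (intro submodule_sum_closed[OF H] summand)
qed

text \<open>The multidegree argument gives exactness in positive homological degree. In degree 0 the
  only basis element is that of the empty face, and there the image of the first differential has to
  be identified with the ideal directly.\<close>

lemma supports_minimal_resolution_criterion:
  fixes m :: "nat \<Rightarrow> nat \<Rightarrow>\<^sub>0 nat"
  assumes U: "finite U" "D \<subseteq> Pow U" and D: "down_closed D" "{} \<in> D" "\<And>j. j \<in> U \<Longrightarrow> {j} \<in> D"
    and m: "\<And>i. i \<in> U \<Longrightarrow> m i \<in> monomials N"
    and labels: "\<And>A j. A \<in> D \<Longrightarrow> j \<in> A \<Longrightarrow> lcm_label m A \<noteq> lcm_label m (A - {j})"
    and ex: "\<And>t. t \<in> monomials N \<Longrightarrow> faces_below D m t \<subseteq> {{}} \<or>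
               exact_chains U (chains_on (faces_below D m t) :: (nat set \<Rightarrow> 'k::field) set)"
  shows "supports_minimal_resolution N D m
           (genideal (poly_ring N) (monomial ` m ` U) :: ((nat \<Rightarrow>\<^sub>0 nat) \<Rightarrow>\<^sub>0 'k) set)"
proof -
  let ?R = "poly_ring N :: ((nat \<Rightarrow>\<^sub>0 nat) \<Rightarrow>\<^sub>0 'k) ring"
  let ?I = "genideal ?R (monomial ` m ` U)"
  let ?F = "face_module N D :: nat \<Rightarrow> ((nat \<Rightarrow>\<^sub>0 nat) \<Rightarrow>\<^sub>0 'k, nat set \<Rightarrow> (nat \<Rightarrow>\<^sub>0 nat) \<Rightarrow>\<^sub>0 'k) module"
  \<comment> \<open>The augmentation: the residue class of the coefficient at the empty
    face.\<close>
  let ?\<epsilon> = "\<lambda>f :: nat set \<Rightarrow> (nat \<Rightarrow>\<^sub>0 nat) \<Rightarrow>\<^sub>0 'k. ?I +>\<^bsub>?R\<^esub> f {}"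
  have gens: "monomial ` m ` U \<subseteq> carrier ?R" using m monomial_in_poly_ring by blast
  have I: "ideal ?I ?R" using ring.genideal_ideal[OF ring_poly_ring gens] .
  have h: "(+>\<^bsub>?R\<^esub>) ?I \<in> ring_hom ?R (?R Quot ?I)" by (rule ideal.rcos_ring_hom[OF I])
  have finD: "finite D" using finite_subset[OF U(2)] U(1) by simp
  have empty: "x {} \<in> carrier ?R" if "x \<in> carrier (?F i)" for x i
    using that by (simp add: carrier_face_module)
  have exact: "boundary D m ` carrier (?F (Suc (Suc i)))
      = {x \<in> carrier (?F (Suc i)). boundary D m x = \<zero>\<^bsub>?F i\<^esub>}" for i
  proof (intro equalityI subsetI)
    fix x assume "x \<in> boundary D m ` carrier (?F (Suc (Suc i)))"
    then show "x \<in> {x \<in> carrier (?F (Suc i)). boundary D m x = \<zero>\<^bsub>?F i\<^esub>}"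
      using boundary_in_face_module[OF U D(1) m] boundary_boundary[OF U D(1) face_module_chains_on]
      by fastforce
  next
    fix x assume "x \<in> {x \<in> carrier (?F (Suc i)). boundary D m x = \<zero>\<^bsub>?F i\<^esub>}"
    then show "x \<in> boundary D m ` carrier (?F (Suc (Suc i)))"
      using boundary_exact[OF U D(1) m ex, of x i] by force
  qed
  have eps: "?\<epsilon> \<in> linear_maps ?R (?F 0) (quotient_module ?R ?I)"
    unfolding linear_maps_def
    using ring_hom_closed[OF h] ring_hom_add[OF h] ring_hom_mult[OF h] empty[of _ 0] by auto
  have surj: "?\<epsilon> ` carrier (?F 0) = carrier (quotient_module ?R ?I)"
  proof (intro equalityI subsetI)
    fix X assume "X \<in> carrier (quotient_module ?R ?I)"
    then obtain a where a: "a \<in> carrier ?R" "X = ?I +>\<^bsub>?R\<^esub> a"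
      by (auto simp: FactRing_def A_RCOSETS_def')
    define x where "x = (\<lambda>A :: nat set. if A = {} then a else 0)"
    have "x \<in> carrier (?F 0)"
      using a(1) D(2) by (simp add: carrier_face_module x_def zero_in_poly_ring)
    then show "X \<in> ?\<epsilon> ` carrier (?F 0)" using a(2) by (intro image_eqI[of _ _ x]) (simp_all add: x_def)
  qed (use ring_hom_closed[OF h] empty in auto)
  \<comment> \<open>At \<open>{}\<close> the sign is 1 and the label is 1, so the weight of the
    vertex \<open>j\<close> is its generator \<open>m j\<close>.\<close>
  have b1: "boundary D m f {} = (\<Sum>j\<in>U. f {j} * monomial (m j))" if "f \<in> carrier (?F 1)" for f
    using boundary_eq[OF U face_module_chains_on[OF that], of m "{}"]
    by (simp add: face_sign_def lcm_label_empty lcm_label_singleton)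
  have b1_closed: "boundary D m f \<in> carrier (?F 0)" if "f \<in> carrier (?F 1)" for f
    using boundary_in_face_module[where f = f and i = 0 and N = N, OF U D(1) m] that by simp
  have "boundary D m ` carrier (?F 1) = {x \<in> carrier (?F 0). ?\<epsilon> x = \<zero>\<^bsub>quotient_module ?R ?I\<^esub>}"
  proof (intro equalityI subsetI)
    fix x assume "x \<in> boundary D m ` carrier (?F 1)"
    then obtain f where f: "f \<in> carrier (?F 1)" "x = boundary D m f" by blast
    have "x {} \<in> ?I"
      unfolding f(2) b1[OF f(1)]
      using f(1) by (intro genideal_sum_closed genideal_mult_closed gens) (auto simp: carrier_face_module)
    then have "?\<epsilon> x = ?I"
      by (intro abelian_subgroup.a_rcos_const abelian_subgroupI3 ideal.axioms(1)[OF I]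
          abelian_group_poly_ring)
    then show "x \<in> {x \<in> carrier (?F 0). ?\<epsilon> x = \<zero>\<^bsub>quotient_module ?R ?I\<^esub>}"
      using b1_closed[OF f(1)] f(2) by simp
  next
    fix x assume "x \<in> {x \<in> carrier (?F 0). ?\<epsilon> x = \<zero>\<^bsub>quotient_module ?R ?I\<^esub>}"
    then have x: "x \<in> carrier (?F 0)" "?\<epsilon> x = ?I" by auto
    then have "x {} \<in> ?I" using ideal.rcos_const_imp_mem[OF I] empty[OF x(1)] by blast
    then obtain c where c: "\<forall>j. c j \<in> carrier ?R" "x {} = (\<Sum>j\<in>U. c j * monomial (m j))"
      using genideal_monomials_finite[where m = m, OF U(1) m] by blast
    \<comment> \<open>The coefficient of the generator \<open>m j\<close> is placed on the vertex
      \<open>{j}\<close>.\<close>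
    define f where "f = (\<lambda>A. if \<exists>j\<in>U. A = {j} then c (the_elem A) else 0)"
    have f: "f \<in> carrier (?F 1)"
      using c(1) D(3) by (auto simp: f_def carrier_face_module zero_in_poly_ring)
    have "boundary D m f A = x A" for A
    proof (cases "A = {}")
      case True
      then show ?thesis using b1[OF f] c(2) by (simp add: f_def)
    next
      case False
      then have "\<not> (A \<in> D \<and> card A = 0)" using finite_face[OF U] by auto
      then show ?thesis
        using x(1) b1_closed[OF f] unfolding carrier_face_module by simp
    qed
    then have "x = boundary D m f" by auto
    then show "x \<in> boundary D m ` carrier (?F 1)" using f by blast
  qed
  then have "free_resolution ?R ?F (\<lambda>_. boundary D m) (quotient_module ?R ?I)"
    unfolding free_resolution_def
    by (intro conjI allI bexI[OF _ eps] module_quotient_module[OF cring_poly_ring I]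
        free_module_face_module[OF finD] boundary_linear_map[OF U D(1) m] exact surj)
  then show ?thesis
    unfolding supports_minimal_resolution_def minimal_free_resolution_def
    using boundary_minimal[OF U D(1) m labels] by blast
qed

section \<open>The nearly Scarf ideal\<close>

text \<open>The map \<open>\<phi>\<close> enumerates the faces, so variable \<open>k\<close> belongs
  to the face \<open>\<phi> k\<close>; the monomial is squarefree.\<close>

definition face_label :: "nat \<Rightarrow> (nat \<Rightarrow> nat set) \<Rightarrow> nat \<Rightarrow> nat \<Rightarrow>\<^sub>0 nat" where
  "face_label N \<phi> i = Abs_poly_mapping (\<lambda>k. if k < N \<and> i \<notin> \<phi> k then 1 else 0)"

lemma lookup_face_label:
  "Poly_Mapping.lookup (face_label N \<phi> i) k = (if k < N \<and> i \<notin> \<phi> k then 1 else 0)"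
proof -
  have "finite {k. (if k < N \<and> i \<notin> \<phi> k then 1 else 0 :: nat) \<noteq> 0}"
    by (rule finite_subset[of _ "{..<N}"]) auto
  then show ?thesis by (simp add: face_label_def)
qed

lemma face_label_in_monomials: "face_label N \<phi> i \<in> monomials N"
  by (auto simp: monomials_def in_keys_iff lookup_face_label split: if_splits)

text \<open>A variable divides the least common multiple as soon as its face misses one vertex of
  \<open>A\<close>, that is, unless its face contains \<open>A\<close>.\<close>

lemma lookup_lcm_face_label:
  assumes "finite A"
  shows "Poly_Mapping.lookup (lcm_label (face_label N \<phi>) A) k = (if k < N \<and> \<not> A \<subseteq> \<phi> k then 1 else 0)"
proof (cases "k < N \<and> \<not> A \<subseteq> \<phi> k")
  case True
  then have "insert 0 ((\<lambda>i. Poly_Mapping.lookup (face_label N \<phi> i) k) ` A) = {0, 1}"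
    by (auto simp: lookup_face_label image_iff)
  then have "Poly_Mapping.lookup (lcm_label (face_label N \<phi>) A) k = Max {0, 1}"
    by (simp only: lookup_lcm_label[OF assms])
  then show ?thesis using True by simp
next
  case False
  then have "insert 0 ((\<lambda>i. Poly_Mapping.lookup (face_label N \<phi> i) k) ` A) = {0}"
    by (auto simp: lookup_face_label)
  then have "Poly_Mapping.lookup (lcm_label (face_label N \<phi>) A) k = Max {0}"
    by (simp only: lookup_lcm_label[OF assms])
  then show ?thesis using False by simp
qed

lemma divides_lcm_face_label:
  assumes "finite A"
  shows "divides (lcm_label (face_label N \<phi>) A) t
           \<longleftrightarrow> (\<forall>k<N. Poly_Mapping.lookup t k = 0 \<longrightarrow> A \<subseteq> \<phi> k)"
  unfolding divides_def lookup_lcm_face_label[OF assms] by (auto simp: Suc_le_eq)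

lemma lcm_face_label_eq_iff:
  assumes \<phi>: "\<phi> ` {..<N} = D" and fin: "finite A" "finite B"
  shows "lcm_label (face_label N \<phi>) A = lcm_label (face_label N \<phi>) B \<longleftrightarrow> (\<forall>F\<in>D. A \<subseteq> F \<longleftrightarrow> B \<subseteq> F)"
proof -
  have "lcm_label (face_label N \<phi>) A = lcm_label (face_label N \<phi>) B
      \<longleftrightarrow> (\<forall>k. (k < N \<and> \<not> A \<subseteq> \<phi> k) \<longleftrightarrow> (k < N \<and> \<not> B \<subseteq> \<phi> k))"
    by (auto simp: poly_mapping_eq_iff fun_eq_iff lookup_lcm_face_label fin split: if_splits)
  also have "\<dots> \<longleftrightarrow> (\<forall>F\<in>D. A \<subseteq> F \<longleftrightarrow> B \<subseteq> F)"
    unfolding \<phi>[symmetric] by blast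
  finally show ?thesis .
qed

lemma divides_face_label_iff:
  assumes "\<phi> ` {..<N} = D"
  shows "divides (face_label N \<phi> i) (face_label N \<phi> j) \<longleftrightarrow> (\<forall>F\<in>D. j \<in> F \<longrightarrow> i \<in> F)"
  using divides_lcm_face_label[of "{i}" N \<phi> "face_label N \<phi> j"] assms
  by (auto simp: lcm_label_singleton lookup_face_label)

text \<open>The label of \<open>A\<close> divides \<open>t\<close> exactly when \<open>A\<close>
  lies in every face whose variable is absent from \<open>t\<close>. With no such face there is no
  restriction; otherwise \<open>A\<close> ranges over the subsets of the intersection of these
  faces, all of them faces by downward closure.\<close>

lemma faces_below_face_label:
  assumes U: "finite U" "D \<subseteq> Pow U" and D: "down_closed D" and \<phi>: "\<phi> ` {..<N} = D"
  shows "faces_below D (face_label N \<phi>) t = D \<or> (\<exists>W\<subseteq>U. faces_below D (face_label N \<phi>) t = Pow W)"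
proof -
  define Z where "Z = {\<phi> k |k. k < N \<and> Poly_Mapping.lookup t k = 0}"
  have ZD: "Z \<subseteq> D" using \<phi> by (auto simp: Z_def)
  have below: "faces_below D (face_label N \<phi>) t = {A \<in> D. \<forall>F\<in>Z. A \<subseteq> F}"
  proof -
    have "divides (lcm_label (face_label N \<phi>) A) t \<longleftrightarrow> (\<forall>F\<in>Z. A \<subseteq> F)" if "A \<in> D" for A
      unfolding divides_lcm_face_label[OF finite_face[OF U that]] Z_def by blast
    then show ?thesis unfolding faces_below_def by blast
  qed
  show ?thesis
  proof (cases "Z = {}")
    case True
    then show ?thesis using below by simp
  next
    case False
    then obtain F where F: "F \<in> Z" by blast
    have "{A \<in> D. \<forall>F\<in>Z. A \<subseteq> F} = Pow (\<Inter>Z)"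
    proof (intro equalityI subsetI)
      fix A assume A: "A \<in> Pow (\<Inter>Z)"
      then have "A \<subseteq> F" using F by blast
      then have "A \<in> D" using down_closedD[OF D] ZD F by blast
      then show "A \<in> {A \<in> D. \<forall>F\<in>Z. A \<subseteq> F}" using A by blast
    qed blast
    moreover have "\<Inter>Z \<subseteq> U" using F ZD U by blast
    ultimately show ?thesis
      unfolding below by (intro disjI2 exI[of _ "\<Inter>Z"]) simp
  qed
qed

lemma scarf_complex_face_label:
  assumes D: "D \<subseteq> Pow {1..n}" "down_closed D" and \<phi>: "\<phi> ` {..<N} = D" and n: "n > 0"
    and ex: "exact_chains {1..n} (chains_on D :: (nat set \<Rightarrow> 'a::comm_ring_1) set)"
  shows "scarf_complex n (face_label N \<phi>) = D"
proof (intro equalityI subsetI)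
  have fin: "finite A" if "A \<subseteq> {1..n}" for A using that finite_subset by blast
  note label_eq = lcm_face_label_eq_iff[OF \<phi> fin fin]
  {
    fix A assume A: "A \<in> scarf_complex n (face_label N \<phi>)"
    show "A \<in> D"
    proof (rule ccontr)
      assume AD: "A \<notin> D"
      have AU: "A \<subseteq> {1..n}" using A by (simp add: scarf_complex_def)
      have "{1..n} \<noteq> {}" using n by simp
      then obtain B where B: "B \<subseteq> {1..n}" "B \<noteq> A" "B \<notin> D"
        using exact_chains_not_simplex_boundary[OF finite_atLeastAtMost D(2,1) _ ex AU AD] by blast
      have "\<not> A \<subseteq> F" "\<not> B \<subseteq> F" if "F \<in> D" for F
        using down_closedD[OF D(2) that] AD B(3) by blast+
      then have "lcm_label (face_label N \<phi>) B = lcm_label (face_label N \<phi>) A"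
        using label_eq[OF B(1) AU] by blast
      then show False using A B unfolding scarf_complex_def by blast
    qed
  next
    fix A assume A: "A \<in> D"
    then have AU: "A \<subseteq> {1..n}" using D by blast
    have "B = A" if B: "B \<subseteq> {1..n}" "lcm_label (face_label N \<phi>) B = lcm_label (face_label N \<phi>) A" for B
    proof -
      \<comment> \<open>The variable of \<open>A\<close> gives \<open>B \<subseteq> A\<close>, which
        makes \<open>B\<close> a face with a variable of its own, and that one gives the converse
        inclusion.\<close>
      have iff: "B \<subseteq> F \<longleftrightarrow> A \<subseteq> F" if "F \<in> D" for F
        using label_eq[OF B(1) AU] B(2) that by blast
      then have "B \<subseteq> A" using A by blast
      then have "B \<in> D" using down_closedD[OF D(2) A] by blast
      then show ?thesis using iff[of B] \<open>B \<subseteq> A\<close> by blast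
    qed
    then show "A \<in> scarf_complex n (face_label N \<phi>)"
      using AU unfolding scarf_complex_def by blast
  }
qed

theorem corollary4p2:
  fixes V :: "'v set" and \<Delta> :: "'v set set" and v :: "nat \<Rightarrow> 'v" and n :: nat
  assumes "simplicial_tree V \<Delta>"
    and "bij_betw v {1..n} V"
  shows "\<exists>(N::nat) (I::((nat \<Rightarrow>\<^sub>0 nat) \<Rightarrow>\<^sub>0 'k::field) set) (m::nat \<Rightarrow> nat \<Rightarrow>\<^sub>0 nat).
           monomial_ideal N I \<and>
           inj_on m {1..n} \<and> minimal_monomial_generators N I (m ` {1..n}) \<and>
           {A. A \<subseteq> {1..n} \<and> v ` A \<in> \<Delta>} = scarf_complex n m \<and>
           supports_minimal_resolution N {A. A \<subseteq> {1..n} \<and> v ` A \<in> \<Delta>} m I"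
proof -
  let ?U = "{1..n}"
  define D where "D = pullback_complex v ?U \<Delta>"
  have D_eq: "{A. A \<subseteq> ?U \<and> v ` A \<in> \<Delta>} = D" by (simp add: D_def pullback_complex_def)
  have vU: "v ` ?U = V" using assms(2) by (simp add: bij_betw_def)
  have cx: "V \<noteq> {}" "down_closed \<Delta>" "\<And>x. x \<in> V \<Longrightarrow> {x} \<in> \<Delta>"
    using assms(1) unfolding simplicial_tree_def simplicial_complex_def down_closed_def by blast+
  have n: "n > 0" using cx(1) vU by (cases n) auto
  have DU: "D \<subseteq> Pow ?U" by (auto simp: D_def pullback_complex_def)
  have down: "down_closed D" unfolding D_def using cx(2) by (rule down_closed_pullback_complex)
  have vert: "{j} \<in> D" if "j \<in> ?U" for j
    using that cx(3) vU by (auto simp: D_def pullback_complex_def)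
  have empty: "{} \<in> D" using down_closedD[OF down vert[of 1]] n by simp
  have ex: "exact_chains ?U (chains_on D :: (nat set \<Rightarrow> 'k) set)"
    unfolding D_def by (rule exact_chains_tree[OF assms(1) finite_atLeastAtMost vU])
  have "finite D" using finite_subset[OF DU] by simp
  then obtain \<phi> where "bij_betw \<phi> {0..<card D} D" using ex_bij_betw_nat_finite by blast
  define N where "N = card D"
  have \<phi>: "\<phi> ` {..<N} = D"
    using \<open>bij_betw \<phi> {0..<card D} D\<close> by (simp add: bij_betw_def N_def lessThan_atLeast0)
  define m where "m = face_label N \<phi>"
  have mN: "m i \<in> monomials N" for i by (simp add: m_def face_label_in_monomials)
  \<comment> \<open>Divisibility is tested at the variable of the face \<open>{j}\<close>: it does
    not divide \<open>m j\<close>, so it must not divide \<open>m i\<close>, which forces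
    \<open>i\<close> into \<open>{j}\<close>.\<close>
  have anti: "i = j" if "i \<in> ?U" "j \<in> ?U" "divides (m i) (m j)" for i j
    using that vert[of j] divides_face_label_iff[OF \<phi>, of i j] unfolding m_def by blast
  have inj: "inj_on m ?U"
    by (rule inj_onI) (metis anti divides_refl)
  have scarf: "scarf_complex n m = D"
    unfolding m_def by (rule scarf_complex_face_label[OF DU down \<phi> n ex])
  define I where "I = (genideal (poly_ring N) (monomial ` m ` ?U) :: ((nat \<Rightarrow>\<^sub>0 nat) \<Rightarrow>\<^sub>0 'k) set)"
  have "monomial_ideal N I"
    unfolding monomial_ideal_def I_def using mN by (intro exI[of _ "m ` ?U"]) auto
  moreover have "minimal_monomial_generators N I (m ` ?U)"
    unfolding I_def
  proof (rule minimal_monomial_generators_antichain)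
    fix s t assume "s \<in> m ` ?U" "t \<in> m ` ?U" "divides s t"
    then show "s = t" using anti by blast
  qed (use mN in blast)
  moreover have "supports_minimal_resolution N D m I"
    unfolding I_def
  proof (rule supports_minimal_resolution_criterion[OF finite_atLeastAtMost DU down empty vert mN])
    fix A j assume A: "A \<in> D" "j \<in> A"
    \<comment> \<open>Minimality comes from the Scarf property: the label of a face is shared with
      no other set, in particular not with \<open>A - {j}\<close>.\<close>
    have "A - {j} \<subseteq> ?U" "A - {j} \<noteq> A" using A DU by blast+
    then show "lcm_label m A \<noteq> lcm_label m (A - {j})"
      using A(1) unfolding scarf[symmetric] scarf_complex_def by (metis (mono_tags, lifting) mem_Collect_eq)
  next
    fix t
    have "faces_below D m t = D \<or> (\<exists>W\<subseteq>?U. faces_below D m t = Pow W)"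
      unfolding m_def by (rule faces_below_face_label[OF finite_atLeastAtMost DU down \<phi>])
    then show "faces_below D m t \<subseteq> {{}} \<or>
        exact_chains ?U (chains_on (faces_below D m t) :: (nat set \<Rightarrow> 'k) set)"
    proof (elim disjE exE conjE)
      fix W assume W: "W \<subseteq> ?U" "faces_below D m t = Pow W"
      show ?thesis
      proof (cases "W = {}")
        case False
        then have "exact_chains ?U (chains_on (Pow W) :: (nat set \<Rightarrow> 'k) set)"
          by (rule exact_chains_Pow[OF finite_atLeastAtMost W(1)])
        then show ?thesis using W(2) by simp
      qed (simp add: W(2))
    qed (use ex in simp)
  qed
  ultimately show ?thesis
    unfolding D_eq using inj scarf by blast
qed

end
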